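(* Let $\Delta=\operatorname{conv}(v_0,\dots,v_d)$ be a $d$-dimensional lattice simplex possessing the integer decomposition property, and suppose that its associated coordinate group $\Lambda_\Delta$ is a non-trivial cyclic group of order $N$. Assume that a generator of $\Lambda_\Delta$ has coordinates of the form $a_j/N$ with integers $0\le a_j<N$ for each $j\in\{0,\dots,d\}$, and that $\gcd(a_j,N)=1$ whenever $a_j\neq0$. Then the $h^*$-polynomial $h^*_\Delta(t)$ is unimodal.
   Context: A lattice $M$ is a free abelian group of finite rank, and $M_{\mathbb{R}}=M\otimes_{\mathbb{Z}}\mathbb{R}$. A lattice polytope $P\subset M_{\mathbb{R}}$ is the convex hull of a finite set of points of $M$; a $d$-dimensional lattice polytope with exactly $d+1$ vertices is a lattice simplex. Integer decomposition property (IDP): for every positive integer $n$, every $z\in nP\cap M$ can be written $z=z_1+\cdots+z_n$ with all $z_i\in P\cap M$. $h^*$-polynomial: $\sum_{n\ge 0}|nP\cap M|t^n=h^*_P(t)/(1-t)^{d+1}$ with $h_P^*(t)=\sum_{i=0}^d h_i^*(P)t^i$ and $d=\dim P$. It is called unimodal if its coefficient sequence $(h_0^*(P),\dots,h_d^*(P))$ is unimodal, i.e. there is $k$ with $h^*_0\le\cdots\le h^*_k\ge\cdots\ge h^*_d$. Coordinate group: for a $d$-dimensional lattice simplex $\Delta=\operatorname{conv}(v_0,\dots,v_d)$, let $w_j=(v_j,1)\in M\oplus\mathbb{Z}$, let $C_\Delta=\mathbb{R}_{\ge0}(\Delta\times\{1\})$, $N_\Delta=\operatorname{span}_{\mathbb{R}}(C_\Delta)\cap(M\oplus\mathbb{Z})$,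 and let $W:\mathbb{R}^{d+1}\to\operatorname{span}_{\mathbb{R}}(C_\Delta)$, $W(\lambda)=\sum_{j=0}^d\lambda_jw_j$ (a linear isomorphism). Define $$\Lambda_\Delta=\{\lambda\in[0,1)^{d+1}\mid W(\lambda)\in N_\Delta\},$$ an abelian group under coordinatewise addition modulo $1$. *)

theory Defs
  imports
    "HOL-Analysis.Analysis"
    "HOL-Algebra.Elementary_Groups"
    "HOL-Computational_Algebra.Polynomial_FPS"
begin

text \<open>
  A free abelian group \<open>M\<close> of finite rank is realised as the set of integer combinations of
  linearly independent vectors in a Euclidean space, so that \<open>M \<otimes> \<real>\<close> is \<open>span M\<close>. This span is
  not required to be the whole space, hence every rank, including 0, is covered. The Euclidean
  structure itself plays no role.
\<close>

definition is_lattice :: "'a::euclidean_space set \<Rightarrow> bool" where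
  "is_lattice M \<longleftrightarrow>
     (\<exists>B. finite B \<and> independent B \<and> M = {\<Sum>b\<in>B. of_int (c b) *\<^sub>R b | c :: 'a \<Rightarrow> int. True})"

definition lattice_polytope :: "'a::euclidean_space set \<Rightarrow> 'a set \<Rightarrow> bool" where
  "lattice_polytope M P \<longleftrightarrow> (\<exists>S. finite S \<and> S \<subseteq> M \<and> P = convex hull S)"

text \<open>The vertices of a polytope are its extreme points.\<close>

definition lattice_simplex :: "'a::euclidean_space set \<Rightarrow> nat \<Rightarrow> 'a set \<Rightarrow> bool" where
  "lattice_simplex M d P \<longleftrightarrow>
     lattice_polytope M P \<and> aff_dim P = int d \<and> card {x. x extreme_point_of P} = d + 1"

definition dilate :: "nat \<Rightarrow> 'a::euclidean_space set \<Rightarrow> 'a set" where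
  "dilate n P = (\<lambda>x. real n *\<^sub>R x) ` P"

definition IDP :: "'a::euclidean_space set \<Rightarrow> 'a set \<Rightarrow> bool" where
  "IDP M P \<longleftrightarrow>
     (\<forall>n\<ge>1. \<forall>z \<in> dilate n P \<inter> M.
        \<exists>y :: nat \<Rightarrow> 'a. (\<forall>i\<in>{1..n}. y i \<in> P \<inter> M) \<and> z = (\<Sum>i=1..n. y i))"

definition ehrhart_series :: "'a::euclidean_space set \<Rightarrow> 'a set \<Rightarrow> int fps" where
  "ehrhart_series M P = Abs_fps (\<lambda>n. int (card (dilate n P \<inter> M)))"

text \<open>
  The defining identity \<open>\<Sum>\<^sub>n |nP \<inter> M| t\<^sup>n = h(t) / (1 - t)\<^sup>d\<^sup>+\<^sup>1\<close>, with denominators cleared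
  (\<open>1 - t\<close> is a unit in the ring of formal power series). It determines \<open>h\<close> uniquely.
\<close>

definition hstar_poly :: "'a::euclidean_space set \<Rightarrow> 'a set \<Rightarrow> int poly" where
  "hstar_poly M P =
     (THE h. degree h \<le> nat (aff_dim P) \<and>
             ehrhart_series M P * (1 - fps_X) ^ (nat (aff_dim P) + 1) = fps_of_poly h)"

definition unimodal_seq :: "nat \<Rightarrow> (nat \<Rightarrow> int) \<Rightarrow> bool" where
  "unimodal_seq d c \<longleftrightarrow>
     (\<exists>k\<le>d. (\<forall>i<k. c i \<le> c (Suc i)) \<and> (\<forall>i. k \<le> i \<and> i < d \<longrightarrow> c (Suc i) \<le> c i))"

definition hstar_unimodal :: "'a::euclidean_space set \<Rightarrow> 'a set \<Rightarrow> bool" where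
  "hstar_unimodal M P \<longleftrightarrow> unimodal_seq (nat (aff_dim P)) (coeff (hstar_poly M P))"

definition W_map :: "nat \<Rightarrow> (nat \<Rightarrow> 'a::euclidean_space) \<Rightarrow> (nat \<Rightarrow> real) \<Rightarrow> 'a \<times> real" where
  "W_map d v l = (\<Sum>j\<le>d. l j *\<^sub>R (v j, 1))"

definition cone_over :: "'a::euclidean_space set \<Rightarrow> ('a \<times> real) set" where
  "cone_over P = cone hull (P \<times> {1})"

definition cone_lattice :: "'a::euclidean_space set \<Rightarrow> 'a set \<Rightarrow> ('a \<times> real) set" where
  "cone_lattice M P = span (cone_over P) \<inter> (M \<times> \<int>)"

text \<open>
  A vector in \<open>[0,1)\<^sup>d\<^sup>+\<^sup>1\<close> is a function on the index set \<open>{0, \<dots>, d}\<close>, extended by \<open>undefined\<close>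
  outside it, so that equality of functions is equality of vectors.
\<close>

definition coord_group ::
    "'a::euclidean_space set \<Rightarrow> nat \<Rightarrow> (nat \<Rightarrow> 'a) \<Rightarrow> (nat \<Rightarrow> real) monoid" where
  "coord_group M d v =
     \<lparr>carrier = {l \<in> {..d} \<rightarrow>\<^sub>E {0..<1}. W_map d v l \<in> cone_lattice M (convex hull (v ` {..d}))},
      mult = (\<lambda>x y. \<lambda>j\<in>{..d}. frac (x j + y j)),
      one = (\<lambda>j\<in>{..d}. 0)\<rparr>"

lemma lattice_arith:
  assumes "is_lattice M"
  shows "0 \<in> M" "x \<in> M \<Longrightarrow> y \<in> M \<Longrightarrow> x - y \<in> M"
proof -
  obtain B where M: "M = {\<Sum>b\<in>B. of_int (c b) *\<^sub>R b | c :: 'a \<Rightarrow> int. True}"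
    using assms unfolding is_lattice_def by blast
  show "0 \<in> M" unfolding M by (auto intro!: exI[of _ "\<lambda>_. 0"])
  assume "x \<in> M" "y \<in> M"
  then obtain c c' :: "'a \<Rightarrow> int" where
    "x = (\<Sum>b\<in>B. of_int (c b) *\<^sub>R b)" "y = (\<Sum>b\<in>B. of_int (c' b) *\<^sub>R b)"
    unfolding M by blast
  then have "x - y = (\<Sum>b\<in>B. of_int (c b - c' b) *\<^sub>R b)"
    by (simp add: sum_subtractf scaleR_left_diff_distrib)
  then show "x - y \<in> M"
    unfolding M by (intro CollectI exI[of _ "\<lambda>b. c b - c' b"] conjI TrueI)
qed

lemma int_scale_closed:
  fixes G :: "'b::real_vector set"
  assumes "0 \<in> G" and diff: "\<And>x y. x \<in> G \<Longrightarrow> y \<in> G \<Longrightarrow> x - y \<in> G" and x: "x \<in> G"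
  shows "of_int k *\<^sub>R x \<in> G"
proof -
  have neg: "- y \<in> G" if "y \<in> G" for y using diff[OF assms(1) that] by simp
  have nat: "of_nat n *\<^sub>R x \<in> G" for n
  proof (induction n)
    case (Suc n)
    then show ?case using diff[OF Suc neg[OF x]] by (simp add: algebra_simps)
  qed (simp add: assms(1))
  show ?thesis
    by (cases k rule: int_cases2) (use nat neg[OF nat] in auto)
qed

lemma cone_lattice_arith:
  assumes "is_lattice M"
  shows "0 \<in> cone_lattice M P"
    "x \<in> cone_lattice M P \<Longrightarrow> y \<in> cone_lattice M P \<Longrightarrow> x - y \<in> cone_lattice M P"
proof -
  have "(0, 0) \<in> span (cone_over P)" by (metis span_zero zero_prod_def)
  then show "0 \<in> cone_lattice M P"
    using lattice_arith(1)[OF assms] by (simp add: cone_lattice_def zero_prod_def)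
  show "x - y \<in> cone_lattice M P" if "x \<in> cone_lattice M P" "y \<in> cone_lattice M P"
    using that lattice_arith(2)[OF assms] by (auto simp: cone_lattice_def span_diff)
qed

lemma W_map_int:
  fixes k :: "nat \<Rightarrow> int"
  assumes M: "is_lattice M" and v: "\<And>j. j \<le> d \<Longrightarrow> v j \<in> M"
  shows "W_map d v (\<lambda>j. of_int (k j)) \<in> cone_lattice M (convex hull (v ` {..d}))"
    (is "_ \<in> ?N")
proof -
  note N = cone_lattice_arith[OF M, where P = "convex hull (v ` {..d})"]
  have w: "(v j, 1) \<in> ?N" if "j \<le> d" for j
  proof -
    have "v j \<in> convex hull (v ` {..d})" using that by (simp add: hull_inc)
    then have "(v j, 1) \<in> cone_over (convex hull (v ` {..d}))"
      unfolding cone_over_def by (intro hull_inc) auto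
    then show ?thesis using v[OF that] by (simp add: cone_lattice_def span_base)
  qed
  have add: "x + y \<in> ?N" if "x \<in> ?N" "y \<in> ?N" for x y
    using N(2)[OF that(1) N(2)[OF N(1) that(2)]] by simp
  have "(\<Sum>j\<in>A. of_int (k j) *\<^sub>R (v j, 1::real)) \<in> ?N" if "finite A" "A \<subseteq> {..d}" for A
    using that
  proof (induction A rule: finite_induct)
    case empty then show ?case by (simp add: N(1))
  next
    case (insert j A)
    have "of_int (k j) *\<^sub>R (v j, 1::real) \<in> ?N"
      using int_scale_closed[OF N w] insert.prems by blast
    then show ?case using add insert by auto
  qed
  from this[of "{..d}"] show ?thesis by (simp only: W_map_def) simp
qed

theorem comm_group_coord_group:
  assumes M: "is_lattice M" and v: "\<And>j. j \<le> d \<Longrightarrow> v j \<in> M"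
  shows "comm_group (coord_group M d v)"
proof -
  let ?N = "cone_lattice M (convex hull (v ` {..d}))" and ?G = "coord_group M d v"
  note N = cone_lattice_arith[OF M, where P = "convex hull (v ` {..d})"]
  have add: "x + y \<in> ?N" if "x \<in> ?N" "y \<in> ?N" for x y
    using N(2)[OF that(1) N(2)[OF N(1) that(2)]] by simp
  have W_restrict: "W_map d v (restrict f {..d}) = W_map d v f" for f
    unfolding W_map_def by (intro sum.cong) auto
  have W_frac: "W_map d v (\<lambda>j. frac (f j)) \<in> ?N" if "W_map d v f \<in> ?N" for f
  proof -
    have "W_map d v (\<lambda>j. frac (f j)) = W_map d v f - W_map d v (\<lambda>j. of_int \<lfloor>f j\<rfloor>)"
      unfolding W_map_def frac_def by (simp only: scaleR_left_diff_distrib sum_subtractf)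
    then show ?thesis using N(2)[OF that W_map_int[OF M v]] by simp
  qed
  have mem: "(\<lambda>j\<in>{..d}. frac (f j)) \<in> carrier ?G" if "W_map d v f \<in> ?N" for f
    using W_frac[OF that] by (auto simp: coord_group_def W_restrict frac_lt_1)
  have car: "W_map d v x \<in> ?N" "x \<in> {..d} \<rightarrow>\<^sub>E {0..<1}" if "x \<in> carrier ?G" for x
    using that by (auto simp: coord_group_def)
  have frac1: "frac (frac a + b) = frac (a + b)" "frac (b + frac a) = frac (b + a)" for a b :: real
    by (simp_all add: frac_def algebra_simps)
  show ?thesis
  proof (rule comm_groupI)
    fix x y assume "x \<in> carrier ?G" "y \<in> carrier ?G"
    then have "W_map d v x + W_map d v y \<in> ?N" using add car(1) by blast
    then have "W_map d v (\<lambda>j. x j + y j) \<in> ?N"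
      by (simp only: W_map_def scaleR_left_distrib sum.distrib)
    from mem[OF this] show "x \<otimes>\<^bsub>?G\<^esub> y \<in> carrier ?G" by (simp add: coord_group_def)
  next
    have "W_map d v (\<lambda>j. 0) \<in> ?N" by (simp only: W_map_def scaleR_zero_left sum.neutral_const N(1))
    from mem[OF this] show "\<one>\<^bsub>?G\<^esub> \<in> carrier ?G" by (simp add: coord_group_def)
  next
    fix x y z
    show "x \<otimes>\<^bsub>?G\<^esub> y \<otimes>\<^bsub>?G\<^esub> z = x \<otimes>\<^bsub>?G\<^esub> (y \<otimes>\<^bsub>?G\<^esub> z)"
      by (auto simp: coord_group_def frac1 add.assoc)
  next
    fix x y show "x \<otimes>\<^bsub>?G\<^esub> y = y \<otimes>\<^bsub>?G\<^esub> x" by (simp add: coord_group_def add.commute)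
  next
    fix x assume x: "x \<in> carrier ?G"
    have "frac (x j) = x j" if "j \<le> d" for j
      using car(2)[OF x] that by (auto simp: frac_eq PiE_iff)
    then show "\<one>\<^bsub>?G\<^esub> \<otimes>\<^bsub>?G\<^esub> x = x" using car(2)[OF x]
      by (auto simp: coord_group_def fun_eq_iff PiE_iff extensional_def)
  next
    fix x assume x: "x \<in> carrier ?G"
    have "W_map d v (\<lambda>j. - x j) \<in> ?N"
      using N(2)[OF N(1) car(1)[OF x]] by (simp only: W_map_def scaleR_minus_left sum_negf) simp
    moreover have "(\<lambda>j\<in>{..d}. frac (- x j)) \<otimes>\<^bsub>?G\<^esub> x = \<one>\<^bsub>?G\<^esub>"
      by (auto simp: coord_group_def frac1)
    ultimately show "\<exists>y\<in>carrier ?G. y \<otimes>\<^bsub>?G\<^esub> x = \<one>\<^bsub>?G\<^esub>" using mem by blast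
  qed
qed

end

theory Submission
  imports Defs "HOL-Library.Poly_Mapping" "HOL-Library.Z2" "HOL-Library.Nat_Bijection"
begin

text \<open>
  The coefficient \<open>h\<^sub>n\<close> of the \<open>h\<^sup>*\<close>-polynomial counts the elements of the coordinate group of height
  (coordinate sum) \<open>n\<close>. Since the nonzero \<open>a\<^sub>j\<close> are units modulo \<open>N\<close>, every nonzero element of the group
  has the same support \<open>S\<close>, and \<open>x \<mapsto> 1 - x\<close> on \<open>S\<close> gives \<open>h\<^sub>n = h\<^sub>s\<^sub>-\<^sub>n\<close> for \<open>0 < n < s = |S|\<close>. What remains
  is \<open>h\<^sub>k \<le> h\<^sub>k\<^sub>+\<^sub>1\<close> for \<open>1 \<le> k < s / 2\<close>.

  This is a weak Lefschetz property, shown by anisotropy in characteristic 2 in the manner of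
  Papadakis and Petrotou. Reduce the interior ideal of the semigroup algebra of the cone modulo generic
  parameters \<open>\<theta>\<^sub>i\<close> over a ring of power series in their coefficients over the field with two elements.
  The toric residue \<open>T\<close> satisfies \<open>T(x\<^sup>q) = (\<Sum>p. a\<^sub>p T(x\<^sup>r)\<^sup>2)\<close> with \<open>2 r = q + (\<Sum>i. p i)\<close>, because Frobenius
  splits the generating function of the residues. If a generic linear form \<open>l\<close> kills a nonzero \<open>u\<close> of degree \<open>k\<close>,
  then \<open>T(l u\<^sup>2 x\<^sup>w) = 0\<close> for all \<open>w\<close>, and comparing coefficients over the subring of squares gives
  \<open>T(u x\<^sup>r) = 0\<close> whenever \<open>2 r\<close> is a sum of points of height 1; by the integer decomposition property
  this covers all \<open>r\<close> of height \<open>s - k\<close>, contradicting the nondegeneracy of the residue pairing.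
\<close>

unbundle no vec_syntax
unbundle fps_syntax

section \<open>Frobenius splitting of power series in characteristic 2\<close>

abbreviation "lookup \<equiv> poly_mapping.lookup"
abbreviation "single \<equiv> Poly_Mapping.single"
abbreviation "keys \<equiv> Poly_Mapping.keys"

type_synonym mono = "nat \<Rightarrow>\<^sub>0 nat"
type_synonym pol = "mono \<Rightarrow>\<^sub>0 bit"

text \<open>Fraction-free Gaussian elimination: cross-multiplying with the pivot
  \<open>A p j\<close> removes one unknown and one equation without division. It is applied to power
  series, which form a domain but not a field.\<close>

lemma homogeneous_system_solution:
  fixes A :: "'i \<Rightarrow> 'j \<Rightarrow> 'r::idom"
  assumes "finite J" "finite I" "card J < card I"
  shows "\<exists>u. (\<exists>i\<in>I. u i \<noteq> 0) \<and> (\<forall>j\<in>J. (\<Sum>i\<in>I. u i * A i j) = 0)"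
  using assms
proof (induction J arbitrary: I A rule: finite_induct)
  case empty
  then have "I \<noteq> {}" by auto
  then show ?case by (auto intro!: exI[of _ "\<lambda>_. 1"])
next
  case (insert j J)
  show ?case
  proof (cases "\<forall>i\<in>I. A i j = 0")
    case True
    obtain u where "\<exists>i\<in>I. u i \<noteq> 0" "\<forall>j\<in>J. (\<Sum>i\<in>I. u i * A i j) = 0"
      using insert.IH[of I A] insert.prems insert.hyps by auto
    then show ?thesis using True by (intro exI[of _ u]) auto
  next
    case False
    then obtain p where p: "p \<in> I" "A p j \<noteq> 0" by blast
    define I' where "I' = I - {p}"
    have I': "finite I'" "card J < card I'" "p \<notin> I'" "I = insert p I'"
      using insert.prems insert.hyps p by (auto simp: I'_def)
    obtain u where u: "\<exists>i\<in>I'. u i \<noteq> 0"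
        "\<forall>j'\<in>J. (\<Sum>i\<in>I'. u i * (A p j * A i j' - A i j * A p j')) = 0"
      using insert.IH[OF I'(1,2), of "\<lambda>i j'. A p j * A i j' - A i j * A p j'"] by blast
    \<comment> \<open>The entry at \<open>p\<close> solves equation \<open>j\<close>; the others are
      scaled by the pivot to avoid dividing by it.\<close>
    define w where "w = (\<lambda>i. if i = p then - (\<Sum>i\<in>I'. u i * A i j) else A p j * u i)"
    have expand: "(\<Sum>i\<in>I. w i * A i j') = - (\<Sum>i\<in>I'. u i * A i j) * A p j' + (\<Sum>i\<in>I'. A p j * u i * A i j')" for j'
    proof -
      have "(\<Sum>i\<in>I. w i * A i j') = w p * A p j' + (\<Sum>i\<in>I'. w i * A i j')"
        using I' by simp
      also have "(\<Sum>i\<in>I'. w i * A i j') = (\<Sum>i\<in>I'. A p j * u i * A i j')"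
        using I'(3) by (intro sum.cong) (auto simp: w_def)
      finally show ?thesis by (simp add: w_def)
    qed
    have "(\<Sum>i\<in>I. w i * A i j') = (\<Sum>i\<in>I'. u i * (A p j * A i j' - A i j * A p j'))" for j'
      unfolding expand
      by (simp add: sum_distrib_right sum_distrib_left sum_subtractf algebra_simps)
    moreover have "(\<Sum>i\<in>I. w i * A i j) = 0"
      unfolding expand by (simp add: sum_distrib_right sum_distrib_left algebra_simps)
    moreover have "\<exists>i\<in>I. w i \<noteq> 0"
      using u(1) p(2) I'(3,4) by (auto simp: w_def)
    ultimately show ?thesis using u(2) by (intro exI[of _ w]) auto
  qed
qed

section \<open>Cancellation of sums in characteristic 2\<close>

lemma pol_add_self [simp]: "(F::pol) + F = 0"
proof (rule poly_mapping_eqI)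
  fix k show "lookup (F + F) k = lookup 0 k"
    unfolding lookup_add by (cases "lookup F k") simp_all
qed

lemma fps_pol_add_self [simp]: "(f::pol fps) + f = 0"
  by (rule fps_ext) (simp only: fps_add_nth fps_zero_nth pol_add_self)

text \<open>The terms at \<open>(x, y)\<close> and \<open>(y, x)\<close> cancel, so a quadratic form
  keeps only its diagonal.\<close>

lemma sum_symmetric_char2:
  fixes f :: "'i \<Rightarrow> 'i \<Rightarrow> 'r::comm_monoid_add"
  assumes char2: "\<And>x::'r. x + x = 0" and sym: "\<And>x y. f x y = f y x" and "finite X"
  shows "(\<Sum>x\<in>X. \<Sum>y\<in>X. f x y) = (\<Sum>x\<in>X. f x x)"
  using \<open>finite X\<close>
proof (induction X rule: finite_induct)
  case (insert a X)
  have "(\<Sum>x\<in>insert a X. \<Sum>y\<in>insert a X. f x y)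
      = f a a + (\<Sum>y\<in>X. f a y) + ((\<Sum>x\<in>X. f x a) + (\<Sum>x\<in>X. \<Sum>y\<in>X. f x y))"
    using insert.hyps by (simp add: sum.distrib add_ac)
  also have "(\<Sum>x\<in>X. f x a) = (\<Sum>y\<in>X. f a y)" using sym by simp
  also have "f a a + r + (r + t) = f a a + t" for r t
    using char2[of r] by (simp only: add.assoc add.assoc[of r r t, symmetric] add_0_left)
  finally show ?case using insert by simp
qed simp

text \<open>The involution \<open>i \<mapsto> k - i\<close> cancels terms in pairs. Only its fixed
  point survives, which exists for even \<open>k\<close> only. The induction peels off both
  ends.\<close>

lemma sum_reflected_char2:
  fixes w :: "nat \<Rightarrow> 'r::comm_monoid_add"
  assumes char2: "\<And>x::'r. x + x = 0" and "\<And>i. i \<le> k \<Longrightarrow> w (k - i) = w i"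
  shows "(\<Sum>i=0..k. w i) = (if even k then w (k div 2) else 0)"
  using assms(2)
proof (induction k arbitrary: w rule: induct_nat_012)
  case 1
  from 1[of 0] have "w (Suc 0) = w 0" by simp
  then show ?case by (simp add: char2)
next
  case (ge2 k)
  have "(\<Sum>i=0..Suc (Suc k). w i) = w 0 + (\<Sum>i=0..k. w (Suc i)) + w (Suc (Suc k))"
    by (simp only: sum.atLeast0_atMost_Suc_shift[of w "Suc k"] sum.atLeast0_atMost_Suc[of _ k] o_def add.assoc)
  also have "w (Suc (Suc k)) = w 0" using ge2.prems[of 0] by simp
  also have "(\<Sum>i=0..k. w (Suc i)) = (if even k then w (Suc (k div 2)) else 0)"
  proof (rule ge2.IH(1))
    fix i assume "i \<le> k"
    then show "w (Suc (k - i)) = w (Suc i)"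
      using ge2.prems[of "Suc i"] by (simp add: Suc_diff_le)
  qed
  also have "w 0 + x + w 0 = x" for x
    using char2[of "w 0"] by (simp only: add.commute[of _ x] add.assoc add_0_right)
  finally show ?case by (simp del: sum.cl_ivl_Suc)
qed simp

text \<open>
  For a squarefree exponent \<open>e\<close>, \<open>sqpart e\<close> is the splitting of Frobenius belonging to the basis
  element \<open>X\<^sup>e\<close> of the polynomial ring over its subring of squares.
\<close>

definition sqpart :: "mono \<Rightarrow> pol \<Rightarrow> pol" where
  "sqpart e F = Poly_Mapping.map_key (\<lambda>m. m + m + e) F"

text \<open>\<open>s\<close> is the power of \<open>fps_X\<close> attached to
  \<open>X\<^sup>e\<close>. It will be the degree of \<open>e\<close> in the \<open>avar\<close>
  variables and may exceed 1.\<close>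

definition sqpart_fps :: "mono \<Rightarrow> nat \<Rightarrow> pol fps \<Rightarrow> pol fps" where
  "sqpart_fps e s f = Abs_fps (\<lambda>n. sqpart e (f $ (2 * n + s)))"

lemma inj_double_shift: "inj (\<lambda>m::mono. m + m + e)"
proof (rule injI)
  fix m m' :: mono
  assume "m + m + e = m' + m' + e"
  then have "lookup m x + lookup m x = lookup m' x + lookup m' x" for x
    by (metis add_right_cancel lookup_add)
  then have "lookup m x = lookup m' x" for x by (metis mult_2 mult_cancel1 zero_neq_numeral)
  then show "m = m'" by (rule poly_mapping_eqI)
qed

lemma double_eq_iff [simp]: "m + m = k + k \<longleftrightarrow> m = k" for m k :: mono
  using inj_eq[OF inj_double_shift[of 0], of m k] by simp

lemma lookup_sqpart: "lookup (sqpart e F) m = lookup F (m + m + e)"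
  by (simp add: sqpart_def map_key.rep_eq[OF inj_double_shift])

lemma sqpart_add: "sqpart e (F + G) = sqpart e F + sqpart e G"
  by (rule poly_mapping_eqI) (simp add: lookup_sqpart lookup_add)

lemma sqpart_0 [simp]: "sqpart e 0 = 0"
  by (rule poly_mapping_eqI) (simp add: lookup_sqpart)

lemma sqpart_sum: "sqpart e (sum F A) = (\<Sum>x\<in>A. sqpart e (F x))"
  by (induction A rule: infinite_finite_induct) (simp_all add: sqpart_add)

text \<open>As \<open>e\<close> is squarefree, \<open>2 k \<le> 2 m + 1\<close> holds in each
  coordinate; hence \<open>k \<le> m\<close>, and \<open>l' = m - k\<close> works.\<close>

lemma double_shift_eq_iff:
  fixes m k l e :: mono
  assumes "\<And>x. lookup e x \<le> 1"
  shows "k + k + l = m + m + e \<longleftrightarrow> (\<exists>l'. l = l' + l' + e \<and> m = k + l')"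
proof
  assume "k + k + l = m + m + e"
  then have eq: "lookup k x + lookup k x + lookup l x = lookup m x + lookup m x + lookup e x" for x
    by (metis lookup_add)
  have le: "lookup k x \<le> lookup m x" for x using eq[of x] assms[of x] by linarith
  have "l = (m - k) + (m - k) + e"
  proof (rule poly_mapping_eqI)
    fix x show "lookup l x = lookup ((m - k) + (m - k) + e) x"
      using eq[of x] le[of x] by (simp add: lookup_add lookup_minus)
  qed
  moreover have "m = k + (m - k)"
    by (rule poly_mapping_eqI) (use le in \<open>simp add: lookup_add lookup_minus\<close>)
  ultimately show "\<exists>l'. l = l' + l' + e \<and> m = k + l'" by blast
qed (auto simp: algebra_simps)

lemma pol_induct [case_names zero monom add]:
  fixes F :: pol
  assumes "P 0" and "\<And>k. P (single k 1)" and "\<And>F G. P F \<Longrightarrow> P G \<Longrightarrow> P (F + G)"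
  shows "P F"
proof (induction F rule: update_induct)
  case const then show ?case by (rule assms(1))
next
  case (update f a b)
  have "b = 1" using update by (metis bit_not_one_iff)
  moreover have "Poly_Mapping.update a b f = f + single a b"
    using update(1) by (intro poly_mapping_eqI)
      (auto simp: lookup_update lookup_add lookup_single in_keys_iff when_def)
  ultimately show ?case using update assms(2,3) by metis
qed

lemma sqpart_monom_sq:
  assumes "\<And>x. lookup e x \<le> 1"
  shows "sqpart e (single k 1 * single k 1 * F) = single k 1 * sqpart e F"
proof (induction F rule: pol_induct)
  case (monom l)
  have "sqpart e (single (k + k + l) 1) = single k 1 * sqpart e (single l 1)"
  proof (cases "\<exists>l'. l = l' + l' + e")
    case True
    then obtain l' where l': "l = l' + l' + e" by blast
    have "sqpart e (single l 1) = single l' 1"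
      by (intro poly_mapping_eqI)
        (simp add: lookup_sqpart lookup_single l' when_def)
    moreover have "sqpart e (single (k + k + l) 1) = single (k + l') 1"
      by (intro poly_mapping_eqI)
        (auto simp: lookup_sqpart lookup_single double_shift_eq_iff[OF assms] l'
          when_def)
    ultimately show ?thesis by (simp add: mult_single)
  next
    case False
    have "sqpart e (single l 1) = 0"
      using False by (intro poly_mapping_eqI) (simp add: lookup_sqpart lookup_single when_def)
    moreover have "sqpart e (single (k + k + l) 1) = 0"
      using False
      by (intro poly_mapping_eqI)
        (simp add: lookup_sqpart lookup_single when_def double_shift_eq_iff[OF assms])
    ultimately show ?thesis by simp
  qed
  then show ?case by (simp add: mult_single)
qed (simp_all add: sqpart_add distrib_left)

text \<open>Squares leave as their roots. Frobenius is additive in characteristic 2, because the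
  mixed terms of \<open>(U + V) * (U + V)\<close> cancel, and this leaves the case of a monomial
  \<open>U\<close>.\<close>

lemma sqpart_sq_mult:
  assumes "\<And>x. lookup e x \<le> 1"
  shows "sqpart e (U * U * F) = U * sqpart e F"
proof (induction U rule: pol_induct)
  case (add U V)
  have "(U + V) * (U + V) * F = U * U * F + V * V * F + (U * V * F + U * V * F)"
    by (simp only: algebra_simps)
  then have "(U + V) * (U + V) * F = U * U * F + V * V * F" by simp
  then show ?case using add by (simp add: sqpart_add distrib_right)
qed (simp_all add: sqpart_monom_sq[OF assms])

lemma fps_pol_square_nth:
  fixes u :: "pol fps"
  shows "(u * u) $ k = (if even k then u $ (k div 2) * u $ (k div 2) else 0)"
proof -
  have "(u * u) $ k = (\<Sum>i=0..k. u $ i * u $ (k - i))" by (rule fps_mult_nth)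
  also have "\<dots> = (if even k then u $ (k div 2) * u $ (k - k div 2) else 0)"
    by (rule sum_reflected_char2) (auto simp: mult.commute)
  moreover have "even k \<Longrightarrow> k - k div 2 = k div 2" by presburger
  ultimately show ?thesis by (cases "even k") (simp_all only: if_True if_False refl)
qed

lemma sqpart_fps_nth [simp]: "sqpart_fps e s f $ n = sqpart e (f $ (2 * n + s))"
  by (simp add: sqpart_fps_def)

lemma sqpart_fps_add: "sqpart_fps e s (f + g) = sqpart_fps e s f + sqpart_fps e s g"
  by (rule fps_ext) (simp add: sqpart_add)

lemma sqpart_fps_0 [simp]: "sqpart_fps e s 0 = 0"
  by (rule fps_ext) simp

lemma sqpart_fps_sum: "sqpart_fps e s (sum f A) = (\<Sum>x\<in>A. sqpart_fps e s (f x))"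
  by (induction A rule: infinite_finite_induct) (simp_all add: sqpart_fps_add)

text \<open>Only even powers of \<open>fps_X\<close> occur in \<open>u * u\<close>. Those beyond
  \<open>2 * n\<close> meet coefficients of \<open>f\<close> of index below \<open>s\<close>, which
  \<open>low\<close> removes.\<close>

lemma sqpart_fps_sq_mult:
  fixes u f :: "pol fps"
  assumes e: "\<And>x. lookup e x \<le> 1" and low: "\<And>k. k < s \<Longrightarrow> sqpart e (f $ k) = 0"
  shows "sqpart_fps e s (u * u * f) = u * sqpart_fps e s f"
proof (rule fps_ext)
  fix n
  have "sqpart_fps e s (u * u * f) $ n = (\<Sum>i=0..2*n+s. sqpart e ((u * u) $ i * f $ (2*n+s-i)))"
    by (simp only: sqpart_fps_nth fps_mult_nth[of "u * u"] sqpart_sum)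
  also have "\<dots> = (\<Sum>i\<in>{i\<in>{0..2*n}. even i}. sqpart e ((u * u) $ i * f $ (2*n+s-i)))"
  proof (rule sum.mono_neutral_right)
    show "\<forall>i\<in>{0..2*n+s} - {i\<in>{0..2*n}. even i}. sqpart e ((u * u) $ i * f $ (2*n+s-i)) = 0"
    proof
      fix i assume i: "i \<in> {0..2*n+s} - {i\<in>{0..2*n}. even i}"
      show "sqpart e ((u * u) $ i * f $ (2*n+s-i)) = 0"
      proof (cases "even i")
        case True
        then have "2*n+s-i < s" using i by auto
        then show ?thesis using True by (simp add: fps_pol_square_nth sqpart_sq_mult[OF e] low)
      qed (simp add: fps_pol_square_nth)
    qed
  qed auto
  also have "\<dots> = (\<Sum>j=0..n. sqpart e ((u * u) $ (2*j) * f $ (2*n+s-2*j)))"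
    by (rule sum.reindex_bij_witness[of _ "\<lambda>j. 2 * j" "\<lambda>i. i div 2"]) auto
  also have "\<dots> = (\<Sum>j=0..n. u $ j * sqpart e (f $ (2*(n-j)+s)))"
    by (rule sum.cong) (auto simp: fps_pol_square_nth sqpart_sq_mult[OF e] diff_mult_distrib2)
  finally show "sqpart_fps e s (u * u * f) $ n = (u * sqpart_fps e s f) $ n"
    by (simp add: fps_mult_nth)
qed

text \<open>With \<open>c = 1\<close>, \<open>fps_X\<close> records the degree
  \<open>\<phi>\<close>; with \<open>c = 0\<close>, no monomial has positive
  \<open>\<phi>\<close>.\<close>

definition graded :: "(mono \<Rightarrow> nat) \<Rightarrow> nat \<Rightarrow> pol fps \<Rightarrow> bool" where
  "graded \<phi> c f \<longleftrightarrow> (\<forall>n. \<forall>m\<in>keys (f $ n). \<phi> m = c * n)"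

lemma gradedD: "graded \<phi> c f \<Longrightarrow> \<phi> m \<noteq> c * n \<Longrightarrow> lookup (f $ n) m = 0"
  by (metis graded_def in_keys_iff)

lemma graded_mult:
  assumes "\<And>m m'. \<phi> (m + m') = \<phi> m + \<phi> m'" "graded \<phi> c f" "graded \<phi> c g"
  shows "graded \<phi> c (f * g)"
  unfolding graded_def
proof (intro allI ballI)
  fix n m assume "m \<in> keys ((f * g) $ n)"
  then have "m \<in> (\<Union>i\<in>{0..n}. keys (f $ i * g $ (n - i)))"
    unfolding fps_mult_nth by (rule subsetD[OF keys_sum])
  then obtain i where i: "i \<le> n" "m \<in> keys (f $ i * g $ (n - i))" by auto
  then obtain x y where "m = x + y" "x \<in> keys (f $ i)" "y \<in> keys (g $ (n - i))"
    using keys_mult by blast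
  then show "\<phi> m = c * n"
    using assms i(1) unfolding graded_def by (metis add_mult_distrib2 le_add_diff_inverse)
qed

lemma graded_1 [simp]: "\<phi> 0 = 0 \<Longrightarrow> graded \<phi> c 1"
  unfolding graded_def fps_one_nth by simp

lemma graded_add: "graded \<phi> c f \<Longrightarrow> graded \<phi> c g \<Longrightarrow> graded \<phi> c (f + g)"
  unfolding graded_def fps_add_nth by (meson UnE subsetD keys_add)

lemma graded_prod:
  assumes "\<And>m m'. \<phi> (m + m') = \<phi> m + \<phi> m'" "\<phi> 0 = 0" "\<And>i. i \<in> I \<Longrightarrow> graded \<phi> c (f i)"
  shows "graded \<phi> c (prod f I)"
  using assms(3) by (induction I rule: infinite_finite_induct) (auto intro!: graded_mult graded_1 assms(1,2))

lemma graded_const_X: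
  "(\<And>m. m \<in> keys b \<Longrightarrow> \<phi> m = c) \<Longrightarrow> graded \<phi> c (fps_const b * fps_X)"
  unfolding graded_def fps_X_mult_right_nth by simp

definition geometric :: "pol \<Rightarrow> pol fps" where
  "geometric b = Abs_fps (\<lambda>n. b ^ n)"

text \<open>Signs do not matter in characteristic 2, so the geometric series of \<open>b\<close>
  also inverts \<open>1 + b * fps_X\<close>.\<close>

lemma geometric_inverse: "(1 + fps_const b * fps_X) * geometric b = 1"
proof (rule fps_ext)
  fix n
  have "((1 + fps_const b * fps_X) * geometric b) $ n = b ^ n + (if n = 0 then 0 else b * b ^ (n - 1))"
    by (simp add: distrib_right mult.assoc geometric_def)
  then show "((1 + fps_const b * fps_X) * geometric b) $ n = 1 $ n"
    by (cases n) simp_all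
qed

lemma graded_geometric:
  assumes "\<And>m m'. \<phi> (m + m') = \<phi> m + \<phi> m'" "\<phi> 0 = 0" "\<And>m. m \<in> keys b \<Longrightarrow> \<phi> m = c"
  shows "graded \<phi> c (geometric b)"
  unfolding graded_def
proof (intro allI ballI)
  fix n m assume "m \<in> keys (geometric b $ n)"
  then show "\<phi> m = c * n"
  proof (induction n arbitrary: m)
    case (Suc n)
    then have "m \<in> keys (b * b ^ n)" by (simp add: geometric_def)
    then obtain x y where "m = x + y" "x \<in> keys b" "y \<in> keys (b ^ n)" using keys_mult by blast
    then show ?case using Suc.IH[of y] assms by (simp add: geometric_def)
  qed (use assms in \<open>auto simp: geometric_def\<close>)
qed

section \<open>Selection of monomials by exponent\<close>

definition filt :: "(mono \<Rightarrow> bool) \<Rightarrow> pol \<Rightarrow> pol" where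
  "filt P F = Poly_Mapping.mapp (\<lambda>m c. if P m then c else 0) F"

lemma lookup_filt: "lookup (filt P F) m = (if P m then lookup F m else 0)"
  by (auto simp: filt_def lookup_mapp in_keys_iff when_def)

lemma filt_0 [simp]: "filt P 0 = 0"
  by (rule poly_mapping_eqI) (simp add: lookup_filt)

lemma filt_add: "filt P (F + G) = filt P F + filt P G"
  by (rule poly_mapping_eqI) (simp add: lookup_filt lookup_add)

lemma filt_sum: "filt P (sum F A) = (\<Sum>x\<in>A. filt P (F x))"
  by (induction A rule: infinite_finite_induct) (simp_all add: filt_add)

lemma keys_filt: "keys (filt P F) \<subseteq> keys F"
  by (auto simp: in_keys_iff lookup_filt split: if_splits)

definition indet :: "nat \<Rightarrow> pol" where
  "indet x = single (single x 1) 1"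

lemma keys_indet [simp]: "keys (indet x) = {single x 1}"
  by (simp add: indet_def)

lemma indet_mult_single: "indet x * single k 1 = single (k + single x 1) 1"
  unfolding indet_def mult_single by (simp only: mult_1 add.commute)

lemma lookup_indet_mult: "lookup (indet x * F) (m + single x 1) = lookup F m"
proof (induction F rule: pol_induct)
  case (monom k)
  then show ?case
    by (simp only: indet_mult_single lookup_single add_right_cancel)
qed (simp_all add: distrib_left lookup_add)

lemma filt_indet_mult:
  assumes "\<And>m. P (m + single x 1) \<longleftrightarrow> Q m"
  shows "filt P (indet x * F) = indet x * filt Q F"
proof (induction F rule: pol_induct)
  case (monom k)
  have "filt P (single (k + single x 1) 1) = indet x * filt Q (single k 1)"
  proof (cases "Q k")
    case True
    then have "filt Q (single k 1) = single k 1"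
      by (intro poly_mapping_eqI) (auto simp: lookup_filt lookup_single when_def)
    moreover have "filt P (single (k + single x 1) 1) = single (k + single x 1) 1"
      using True assms[of k] by (intro poly_mapping_eqI) (auto simp: lookup_filt lookup_single when_def)
    ultimately show ?thesis by (simp only: indet_mult_single)
  next
    case False
    then have "filt Q (single k 1) = 0"
      by (intro poly_mapping_eqI) (auto simp: lookup_filt lookup_single when_def)
    moreover have "filt P (single (k + single x 1) 1) = 0"
      using False assms[of k] by (intro poly_mapping_eqI) (auto simp: lookup_filt lookup_single when_def)
    ultimately show ?thesis by (simp only: mult_zero_right)
  qed
  then show ?case by (simp only: indet_mult_single)
qed (simp_all add: filt_add distrib_left)

section \<open>Residues with generic parameters\<close>

text \<open>
  The \<open>i\<close>-th parameter is \<open>\<theta>\<^sub>i = x\<^sup>u - (\<Sum>k. a\<^sub>i\<^sub>k x\<^sup>g)\<close> with \<open>u\<close> the \<open>i\<close>-th unit vector, \<open>g = g\<^sub>k\<close> and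
  \<open>a\<^sub>i\<^sub>k = indet (avar i k) * fps_X\<close>, so that \<open>fps_X\<close> records the total degree in the \<open>a\<^sub>i\<^sub>k\<close>. The
  coefficients of the additional generic linear form are \<open>indet (cvar k)\<close>.
\<close>

definition avar :: "nat \<Rightarrow> nat \<Rightarrow> nat" where "avar i k = prod_encode (Suc i, k)"
definition cvar :: "nat \<Rightarrow> nat" where "cvar k = prod_encode (0, k)"

lemma var_eq_iff [simp]:
  "avar i k = avar j l \<longleftrightarrow> i = j \<and> k = l" "cvar k = cvar l \<longleftrightarrow> k = l"
  "avar i k \<noteq> cvar l" "cvar l \<noteq> avar i k"
  by (simp_all add: avar_def cvar_def)

lemma prod_linear_top:
  fixes b :: "'b \<Rightarrow> 'a::comm_ring_1"
  assumes "finite A"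
  shows "(\<Prod>i\<in>A. 1 + fps_const (b i) * fps_X) $ card A = (\<Prod>i\<in>A. b i)
    \<and> (\<forall>n>card A. (\<Prod>i\<in>A. 1 + fps_const (b i) * fps_X) $ n = 0)"
  using assms
proof (induction A rule: finite_induct)
  case (insert a A)
  then show ?case by (simp add: distrib_right mult.assoc)
qed simp

text \<open>\<open>S\<close> indexes the coordinates as well as the parameters, and \<open>g\<close>
  will list the \<open>r\<close> box points of height 1.\<close>

locale expansion =
  fixes S :: "nat set" and r :: nat and g :: "nat \<Rightarrow> nat \<Rightarrow> real"
  assumes finite_S: "finite S" and g_nonneg: "k < r \<Longrightarrow> j \<in> S \<Longrightarrow> 0 \<le> g k j"
begin

definition \<beta> :: "nat \<Rightarrow> pol" where "\<beta> i = (\<Sum>k<r. indet (avar i k))"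

definition \<nu> :: "nat \<Rightarrow> mono \<Rightarrow> nat" where "\<nu> i m = (\<Sum>k<r. lookup m (avar i k))"

definition weight :: "mono \<Rightarrow> nat \<Rightarrow> real" where
  "weight m j = (\<Sum>i\<in>S. \<Sum>k<r. real (lookup m (avar i k)) * g k j)"

definition tdeg :: "mono \<Rightarrow> nat" where "tdeg m = (\<Sum>i\<in>S. \<nu> i m)"

text \<open>The product of all \<open>x\<^sub>i / \<theta>\<^sub>i\<close> with every
  \<open>x\<^sub>i\<close> set to 1. Nothing is lost: \<open>weight\<close> and \<open>\<nu>\<close>
  recover the exponents of the \<open>x\<^sub>i\<close> from the monomial in the
  \<open>a\<^sub>i\<^sub>k\<close>.\<close>

definition \<Phi> :: "pol fps" where "\<Phi> = (\<Prod>i\<in>S. geometric (\<beta> i))"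

text \<open>
  \<open>T q\<close> is the toric residue of \<open>x\<^sup>q / \<Prod>i. \<theta>\<^sub>i\<close>, expanded in powers of the \<open>a\<^sub>i\<^sub>k\<close>: the monomial \<open>m\<close> of \<open>\<Phi>\<close>
  carries the exponent \<open>q + weight m - \<nu> m\<close>, and the residue picks out the exponent \<open>(1, \<dots>, 1)\<close>.
\<close>

definition admissible :: "(nat \<Rightarrow> real) \<Rightarrow> mono \<Rightarrow> bool" where
  "admissible q m \<longleftrightarrow> (\<forall>j\<in>S. q j + weight m j = real (\<nu> j m) + 1)"

definition T :: "(nat \<Rightarrow> real) \<Rightarrow> pol fps" where
  "T q = Abs_fps (\<lambda>n. filt (admissible q) (\<Phi> $ n))"

lemma T_nth [simp]: "T q $ n = filt (admissible q) (\<Phi> $ n)"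
  by (simp add: T_def)

lemma T_cong: "(\<And>j. j \<in> S \<Longrightarrow> q j = q' j) \<Longrightarrow> T q = T q'"
  by (simp add: T_def admissible_def[abs_def])

lemma \<nu>_simps:
  "\<nu> i 0 = 0" "\<nu> i (m + m') = \<nu> i m + \<nu> i m'"
  "k < r \<Longrightarrow> \<nu> i (single (avar j k) (Suc 0)) = (if i = j then 1 else 0)"
  "\<nu> i (single (cvar k) (Suc 0)) = 0"
  by (simp_all add: \<nu>_def lookup_add sum.distrib lookup_single when_def)

lemma weight_simps:
  "weight 0 j = 0" "weight (m + m') j = weight m j + weight m' j"
  "k < r \<Longrightarrow> i \<in> S \<Longrightarrow> weight (single (avar i k) (Suc 0)) j = g k j"
proof -
  assume k: "k < r" "i \<in> S"
  have "(\<Sum>k'<r. real (lookup (single (avar i k) (Suc 0)) (avar i' k')) * g k' j)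
      = (if i' = i then g k j else 0)" for i'
    using k by (simp add: lookup_single when_def if_distrib[of real] if_distrib[of "\<lambda>x. x * _"] cong: if_cong)
  then show "weight (single (avar i k) (Suc 0)) j = g k j"
    using k finite_S by (simp add: weight_def)
qed (simp_all add: weight_def lookup_add sum.distrib lookup_single when_def distrib_right)

lemma tdeg_simps:
  "tdeg 0 = 0" "tdeg (m + m') = tdeg m + tdeg m'"
  "k < r \<Longrightarrow> i \<in> S \<Longrightarrow> tdeg (single (avar i k) (Suc 0)) = 1"
  "tdeg (single (cvar k) (Suc 0)) = 0"
  using finite_S by (simp_all add: tdeg_def \<nu>_simps sum.distrib)

lemma weight_nonneg: "j \<in> S \<Longrightarrow> 0 \<le> weight m j"
  unfolding weight_def by (intro sum_nonneg mult_nonneg_nonneg g_nonneg) auto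

lemma keys_\<beta>: "m \<in> keys (\<beta> i) \<Longrightarrow> \<exists>k<r. m = single (avar i k) (Suc 0)"
  unfolding \<beta>_def by (drule subsetD[OF keys_sum]) auto

lemma graded_tdeg_\<Phi>: "graded tdeg 1 \<Phi>"
  unfolding \<Phi>_def
  by (intro graded_prod graded_geometric) (auto dest!: keys_\<beta> simp: tdeg_simps)

lemma graded_cvar_\<Phi>: "graded (\<lambda>m. lookup m (cvar k)) 0 \<Phi>"
  unfolding \<Phi>_def
  by (intro graded_prod graded_geometric) (auto dest!: keys_\<beta> simp: lookup_add lookup_single)

text \<open>The residue vanishes on multiples of \<open>\<theta>\<^sub>i\<close>. Such a multiple
  cancels the factor \<open>1 / \<theta>\<^sub>i\<close> and leaves \<open>\<Psi>\<close>, whose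
  monomials no longer lower the \<open>i\<close>-th exponent; by \<open>0 < q i\<close> that
  exponent stays above 1.\<close>

lemma T_step:
  assumes i: "i \<in> S" and q: "0 < q i" and q': "\<And>j. j \<in> S \<Longrightarrow> q' j = q j + (if j = i then 1 else 0)"
  shows "T q' = (\<Sum>k<r. fps_const (indet (avar i k)) * fps_X * T (\<lambda>j. q j + g k j))"
proof -
  define \<Psi> where "\<Psi> = (\<Prod>j\<in>S-{i}. geometric (\<beta> j))"
  have "\<Phi> = geometric (\<beta> i) * \<Psi>"
    unfolding \<Phi>_def \<Psi>_def using finite_S i by (rule prod.remove)
  then have "\<Psi> = (1 + fps_const (\<beta> i) * fps_X) * \<Phi>"
    using geometric_inverse[of "\<beta> i"] by (simp flip: mult.assoc)
  then have "\<Psi> + fps_const (\<beta> i) * fps_X * \<Phi>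
      = \<Phi> + (fps_const (\<beta> i) * fps_X * \<Phi> + fps_const (\<beta> i) * fps_X * \<Phi>)"
    by (simp only: \<open>\<Psi> = _ * \<Phi>\<close> distrib_right mult_1 add.assoc)
  then have \<Phi>: "\<Phi> = \<Psi> + fps_const (\<beta> i) * fps_X * \<Phi>"
    by (simp only: fps_pol_add_self add_0_right)
  have "graded (\<nu> i) 0 \<Psi>"
    unfolding \<Psi>_def by (intro graded_prod graded_geometric) (auto dest!: keys_\<beta> simp: \<nu>_simps)
  have \<Psi>: "filt (admissible q') (\<Psi> $ n) = 0" for n
  proof (rule poly_mapping_eqI)
    fix m show "lookup (filt (admissible q') (\<Psi> $ n)) m = lookup 0 m"
    proof (cases "\<nu> i m = 0")
      case True
      then have "\<not> admissible q' m"
        using i q q'[OF i] weight_nonneg[OF i, of m]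
        by (auto simp: admissible_def intro!: bexI[of _ i])
      then show ?thesis by (simp add: lookup_filt)
    next
      case False
      then show ?thesis using gradedD[OF \<open>graded (\<nu> i) 0 \<Psi>\<close>, of m n] by (simp add: lookup_filt)
    qed
  qed
  have adm: "admissible q' (m + single (avar i k) 1) \<longleftrightarrow> admissible (\<lambda>j. q j + g k j) m" if "k < r" for k m
    unfolding admissible_def using i q' that by (intro ball_cong) (auto simp: \<nu>_simps weight_simps)
  show ?thesis
  proof (rule fps_ext)
    fix n
    have "T q' $ n = filt (admissible q') ((fps_const (\<beta> i) * fps_X * \<Phi>) $ n)"
      unfolding T_nth by (subst \<Phi>) (simp only: fps_add_nth filt_add \<Psi> add_0_left)
    also have "\<dots> = (if n = 0 then 0 else filt (admissible q') (\<beta> i * \<Phi> $ (n - 1)))"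
      by (simp add: mult.assoc)
    also have "filt (admissible q') (\<beta> i * \<Phi> $ (n - 1))
        = (\<Sum>k<r. indet (avar i k) * filt (admissible (\<lambda>j. q j + g k j)) (\<Phi> $ (n - 1)))"
      unfolding \<beta>_def sum_distrib_right filt_sum
      by (intro sum.cong refl filt_indet_mult) (use adm in auto)
    also have "(if n = 0 then 0 else \<dots>)
        = (\<Sum>k<r. fps_const (indet (avar i k)) * fps_X * T (\<lambda>j. q j + g k j)) $ n"
      by (simp add: fps_sum_nth mult.assoc)
    finally show "T q' $ n = \<dots>" .
  qed
qed

section \<open>Frobenius splitting of the residues\<close>

definition lin :: "pol fps" where "lin = (\<Prod>i\<in>S. 1 + fps_const (\<beta> i) * fps_X)"

lemma graded_tdeg_lin: "graded tdeg 1 lin"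
  unfolding lin_def
  by (intro graded_prod graded_add graded_const_X graded_1) (auto dest!: keys_\<beta> simp: tdeg_simps)

lemma lin_\<Phi>: "lin * \<Phi> = 1"
  unfolding lin_def \<Phi>_def by (simp add: geometric_inverse flip: prod.distrib)

text \<open>Exponent of a monomial of \<open>\<Prod>i\<in>S. \<beta> i\<close>, choosing one
  variable from each parameter. These are the squarefree exponents at which the residues are
  split.\<close>

definition expo :: "(nat \<Rightarrow> nat) \<Rightarrow> mono" where
  "expo p = (\<Sum>i\<in>S. single (avar i (p i)) 1)"

lemma lookup_expo: "lookup (expo p) x = (if \<exists>i\<in>S. x = avar i (p i) then 1 else 0)"
proof (cases "\<exists>i\<in>S. x = avar i (p i)")
  case True
  then obtain i where i: "i \<in> S" "x = avar i (p i)" by blast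
  have "lookup (expo p) x = (\<Sum>j\<in>S. if i = j then 1 else 0)"
    unfolding expo_def lookup_sum by (rule sum.cong) (auto simp: i lookup_single when_def)
  then show ?thesis using i finite_S by auto
next
  case False
  then have "lookup (single (avar i (p i)) (Suc 0)) x = 0" if "i \<in> S" for i
    using that by (auto simp: lookup_single when_def)
  then show ?thesis using False by (simp add: expo_def lookup_sum)
qed

lemma expo_simps:
  assumes "p \<in> S \<rightarrow> {..<r}"
  shows "j \<in> S \<Longrightarrow> \<nu> j (expo p) = 1" "weight (expo p) j = (\<Sum>i\<in>S. g (p i) j)" "tdeg (expo p) = card S"
proof -
  have p: "p i < r" if "i \<in> S" for i using assms that by auto
  have additive: "\<phi> (sum f A) = (\<Sum>i\<in>A. \<phi> (f i))"
    if "\<phi> 0 = 0" "\<And>m m'. \<phi> (m + m') = \<phi> m + \<phi> m'"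
    for \<phi> :: "mono \<Rightarrow> 'x::comm_monoid_add" and f and A :: "nat set"
    by (induction A rule: infinite_finite_induct) (simp_all add: that)
  show "\<nu> j (expo p) = 1" if "j \<in> S"
    unfolding expo_def using that p finite_S by (subst additive) (simp_all add: \<nu>_simps)
  show "weight (expo p) j = (\<Sum>i\<in>S. g (p i) j)"
    unfolding expo_def using p by (subst additive[of "\<lambda>m. weight m j"]) (simp_all add: weight_simps)
  show "tdeg (expo p) = card S"
    unfolding expo_def using p by (subst additive) (simp_all add: tdeg_simps)
qed

text \<open>Supplies the assumption \<open>low\<close> of \<open>sqpart_fps_sq_mult\<close>: the
  sampled monomials have degree at least \<open>tdeg e\<close>, which is above
  \<open>k\<close>.\<close>

lemma sqpart_graded_low:
  assumes "graded tdeg 1 f" "k < tdeg e"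
  shows "sqpart e (f $ k) = 0"
proof (rule poly_mapping_eqI)
  fix m
  have "tdeg (m + m + e) \<noteq> 1 * k" using assms(2) by (simp add: tdeg_simps)
  from gradedD[OF assms(1) this] show "lookup (sqpart e (f $ k)) m = lookup 0 m"
    by (simp add: lookup_sqpart)
qed

text \<open>\<open>lin\<close> has degree at most \<open>card S\<close> in \<open>fps_X\<close>, so
  only its top coefficient \<open>\<Prod>i\<in>S. \<beta> i\<close> contributes. That product
  contains the monomial of \<open>expo p\<close> once and no other monomial that is a square times
  it.\<close>

lemma sqpart_lin:
  assumes p: "p \<in> S \<rightarrow> {..<r}"
  shows "sqpart_fps (expo p) (card S) lin = 1"
proof (rule fps_ext)
  fix n
  have top: "sqpart (expo p) (\<Prod>i\<in>S. \<beta> i) = 1"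
  proof -
    define p' where "p' = restrict p S"
    have p': "p' \<in> S \<rightarrow>\<^sub>E {..<r}" "expo p' = expo p"
      using p by (auto simp: p'_def expo_def)
    have prod_indet: "(\<Prod>i\<in>A. indet (avar i (\<pi> i))) = single (\<Sum>i\<in>A. single (avar i (\<pi> i)) 1) 1" for \<pi> A
      by (induction A rule: infinite_finite_induct) (simp_all add: indet_def mult_single)
    have expo_inj: "\<pi> = p'" if eq: "m + m + expo p = expo \<pi>" and \<pi>: "\<pi> \<in> S \<rightarrow>\<^sub>E {..<r}" for \<pi> m
    proof (rule PiE_ext[OF \<pi> p'(1)])
      fix i assume i: "i \<in> S"
      have "lookup (m + m + expo p) (avar i (p i)) = lookup (expo \<pi>) (avar i (p i))" using eq by simp
      then have "\<exists>j\<in>S. avar i (p i) = avar j (\<pi> j)"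
        using i by (auto simp: lookup_add lookup_expo split: if_splits)
      then show "\<pi> i = p' i" using i by (auto simp: p'_def)
    qed
    have "(\<Prod>i\<in>S. \<beta> i) = (\<Sum>\<pi>\<in>S \<rightarrow>\<^sub>E {..<r}. single (expo \<pi>) 1)"
      unfolding \<beta>_def using finite_S by (subst prod_sum_PiE) (simp_all add: prod_indet expo_def)
    then have "sqpart (expo p) (\<Prod>i\<in>S. \<beta> i) = (\<Sum>\<pi>\<in>S \<rightarrow>\<^sub>E {..<r}. sqpart (expo p) (single (expo \<pi>) 1))"
      by (simp only: sqpart_sum)
    also have "\<dots> = (\<Sum>\<pi>\<in>S \<rightarrow>\<^sub>E {..<r}. if \<pi> = p' then 1 else 0)"
    proof (rule sum.cong[OF refl], rule poly_mapping_eqI)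
      fix \<pi> m assume \<pi>: "\<pi> \<in> S \<rightarrow>\<^sub>E {..<r}"
      have "lookup (sqpart (expo p) (single (expo \<pi>) 1)) m = (1 when expo \<pi> = m + m + expo p)"
        by (simp add: lookup_sqpart lookup_single)
      also have "expo \<pi> = m + m + expo p \<longleftrightarrow> \<pi> = p' \<and> m = 0"
        using expo_inj[OF _ \<pi>, of m] p'(2) double_eq_iff[of m 0]
        by (metis add_0 add_right_cancel)
      finally show "lookup (sqpart (expo p) (single (expo \<pi>) 1)) m = lookup (if \<pi> = p' then 1 else 0) m"
        by (simp add: lookup_one when_def)
    qed
    also have "\<dots> = 1" using p'(1) finite_S by (simp add: finite_PiE)
    finally show ?thesis .
  qed
  show "sqpart_fps (expo p) (card S) lin $ n = 1 $ n"
    using prod_linear_top[OF finite_S, of \<beta>] top by (cases "n = 0") (simp_all add: lin_def)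
qed

text \<open>Since \<open>lin\<close> inverts \<open>\<Phi>\<close>, one has
  \<open>\<Phi> = \<Phi> * \<Phi> * lin\<close>. The square leaves as \<open>\<Phi>\<close>, and the
  splitting of \<open>lin\<close> is 1.\<close>

lemma sqpart_\<Phi>:
  assumes p: "p \<in> S \<rightarrow> {..<r}"
  shows "sqpart_fps (expo p) (card S) \<Phi> = \<Phi>"
proof -
  have "\<Phi> = \<Phi> * \<Phi> * lin" using lin_\<Phi> by (metis mult.assoc mult.commute mult_1_right)
  then have "sqpart_fps (expo p) (card S) \<Phi> = sqpart_fps (expo p) (card S) (\<Phi> * \<Phi> * lin)"
    by (rule arg_cong)
  also have "\<dots> = \<Phi> * sqpart_fps (expo p) (card S) lin"
    by (rule sqpart_fps_sq_mult)
      (use expo_simps[OF p] in \<open>simp_all add: lookup_expo sqpart_graded_low[OF graded_tdeg_lin]\<close>)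
  finally show ?thesis by (simp add: sqpart_lin[OF p])
qed

text \<open>At \<open>m + m + expo p\<close>, admissibility for \<open>q\<close> reads \<open>q + 2
  * weight m + (\<Sum>i\<in>S. g (p i)) = 2 * \<nu> m + 2\<close>; halving it gives admissibility of
  \<open>m\<close> for \<open>q'\<close>.\<close>

lemma sqpart_T:
  assumes p: "p \<in> S \<rightarrow> {..<r}" and q: "\<And>j. j \<in> S \<Longrightarrow> q j + (\<Sum>i\<in>S. g (p i) j) = 2 * q' j"
  shows "sqpart_fps (expo p) (card S) (T q) = T q'"
proof (rule fps_ext, rule poly_mapping_eqI)
  fix n m
  have adm: "admissible q (m + m + expo p) \<longleftrightarrow> admissible q' m"
    unfolding admissible_def
  proof (intro ball_cong refl)
    fix j assume j: "j \<in> S"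
    show "(q j + weight (m + m + expo p) j = real (\<nu> j (m + m + expo p)) + 1) =
        (q' j + weight m j = real (\<nu> j m) + 1)"
      using expo_simps(1,2)[OF p] j q[OF j] by (simp add: \<nu>_simps weight_simps) linarith
  qed
  have "sqpart_fps (expo p) (card S) \<Phi> $ n = \<Phi> $ n" by (simp only: sqpart_\<Phi>[OF p])
  then have "lookup (\<Phi> $ (2 * n + card S)) (m + m + expo p) = lookup (\<Phi> $ n) m"
    by (simp flip: lookup_sqpart)
  then show "lookup (sqpart_fps (expo p) (card S) (T q) $ n) m = lookup (T q' $ n) m"
    by (simp add: lookup_sqpart lookup_filt adm)
qed

text \<open>Modulo \<open>fps_X\<close> each \<open>\<theta>\<^sub>i\<close> is just a coordinate,
  so only the exponent \<open>(1, ..., 1)\<close> has a nonzero residue.\<close>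

lemma T_constant: "T q $ 0 = (if \<forall>j\<in>S. q j = 1 then 1 else 0)"
proof -
  have "\<Phi> $ 0 = 1"
    unfolding \<Phi>_def by (induction S rule: infinite_finite_induct) (simp_all add: geometric_def)
  moreover have "filt P 1 = (if P 0 then 1 else 0)" for P
    by (rule poly_mapping_eqI) (auto simp: lookup_filt lookup_one when_def)
  ultimately show ?thesis by (simp add: admissible_def weight_simps \<nu>_simps)
qed

text \<open>The variables \<open>cvar\<close> occur neither in \<open>T q\<close> nor in
  \<open>expo p\<close>, so sampling at \<open>cvar l\<close> isolates one term of the generic
  linear form. For \<open>k \<noteq> l\<close> the exponent of \<open>cvar l\<close> would have to
  be both odd and 0.\<close>

lemma sqpart_cvar_T:
  assumes p: "p \<in> S \<rightarrow> {..<r}"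
    and q: "\<And>j. j \<in> S \<Longrightarrow> q j + (\<Sum>i\<in>S. g (p i) j) = 2 * q' j"
  shows "sqpart_fps (expo p + single (cvar l) 1) (card S) (u * u * (fps_const (indet (cvar k)) * T q))
    = (if k = l then u * T q' else 0)"
proof -
  let ?e = "expo p + single (cvar l) 1"
  have grT: "graded tdeg 1 (T q)" "graded (\<lambda>m. lookup m (cvar l)) 0 (T q)"
    using graded_tdeg_\<Phi> graded_cvar_\<Phi>[of l] subsetD[OF keys_filt]
    unfolding graded_def T_nth by (fast, fast)
  have gr: "graded tdeg 1 (fps_const (indet (cvar k)) * T q)"
    unfolding graded_def
  proof (intro allI ballI)
    fix n m assume "m \<in> keys ((fps_const (indet (cvar k)) * T q) $ n)"
    then have "m \<in> keys (indet (cvar k) * T q $ n)" by simp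
    then obtain y where "m = single (cvar k) 1 + y" "y \<in> keys (T q $ n)"
      using keys_mult[of "indet (cvar k)" "T q $ n"] by auto
    then show "tdeg m = 1 * n" using grT(1) by (simp add: graded_def tdeg_simps)
  qed
  have e: "lookup ?e x \<le> 1" for x
    by (auto simp: lookup_add lookup_expo lookup_single when_def)
  have "tdeg ?e = card S" using expo_simps(3)[OF p] by (simp add: tdeg_simps)
  then have "sqpart_fps ?e (card S) (u * u * (fps_const (indet (cvar k)) * T q))
      = u * sqpart_fps ?e (card S) (fps_const (indet (cvar k)) * T q)"
    by (intro sqpart_fps_sq_mult e sqpart_graded_low[OF gr]) simp
  also have "sqpart_fps ?e (card S) (fps_const (indet (cvar k)) * T q) = (if k = l then T q' else 0)"
  proof (cases "k = l")
    case True
    have "sqpart ?e (indet (cvar l) * F) = sqpart (expo p) F" for F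
      by (rule poly_mapping_eqI) (simp only: lookup_sqpart add.assoc[symmetric] lookup_indet_mult)
    then have "sqpart_fps ?e (card S) (fps_const (indet (cvar l)) * T q) = sqpart_fps (expo p) (card S) (T q)"
      by (intro fps_ext) simp
    then show ?thesis using True sqpart_T[OF p q] by simp
  next
    case False
    have "sqpart ?e (indet (cvar k) * T q $ n) = 0" for n
    proof (rule poly_mapping_eqI)
      fix m
      have "m + m + ?e \<notin> keys (indet (cvar k) * T q $ n)"
      proof
        assume "m + m + ?e \<in> keys (indet (cvar k) * T q $ n)"
        then obtain y where y: "m + m + ?e = single (cvar k) 1 + y" "y \<in> keys (T q $ n)"
          using keys_mult[of "indet (cvar k)" "T q $ n"] by auto
        have "lookup (m + m + ?e) (cvar l) = lookup (single (cvar k) 1 + y) (cvar l)"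
          by (simp only: y(1))
        then show False
          using grT(2) y(2) False by (simp add: graded_def lookup_add lookup_single when_def)
      qed
      then show "lookup (sqpart ?e (indet (cvar k) * T q $ n)) m = lookup 0 m"
        by (simp add: lookup_sqpart in_keys_iff)
    qed
    then show ?thesis using False by (intro fps_ext) simp
  qed
  finally show ?thesis by simp
qed

end

section \<open>Layers of box points\<close>

text \<open>\<open>L\<close> models the barycentric coordinates of lattice points supported on
  \<open>S\<close>. The axiom \<open>zero_coord\<close> says that a nonzero box point has full
  support; this is where the coprimality of the generator enters.\<close>

locale box_lattice =
  fixes S :: "nat set" and L :: "(nat \<Rightarrow> real) set"
  assumes finite_S: "finite S"
    and outside: "x \<in> L \<Longrightarrow> j \<notin> S \<Longrightarrow> x j = 0"
    and diff: "x \<in> L \<Longrightarrow> y \<in> L \<Longrightarrow> (\<lambda>j. x j - y j) \<in> L"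
    and unit: "i \<in> S \<Longrightarrow> (\<lambda>j. if j = i then 1 else 0) \<in> L"
    and zero_coord: "x \<in> L \<Longrightarrow> (\<And>j. j \<in> S \<Longrightarrow> 0 \<le> x j \<and> x j < 1) \<Longrightarrow> i \<in> S \<Longrightarrow> x i = 0 \<Longrightarrow> j \<in> S \<Longrightarrow> x j = 0"
begin

definition layer :: "nat \<Rightarrow> (nat \<Rightarrow> real) set" where
  "layer n = {x \<in> L. (\<forall>j\<in>S. 0 \<le> x j \<and> x j < 1) \<and> (\<Sum>j\<in>S. x j) = real n}"

lemma layerD:
  assumes "x \<in> layer n"
  shows "x \<in> L" "j \<in> S \<Longrightarrow> 0 \<le> x j" "j \<in> S \<Longrightarrow> x j < 1" "(\<Sum>j\<in>S. x j) = real n"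
  using assms by (auto simp: layer_def)

lemma add: "x \<in> L \<Longrightarrow> y \<in> L \<Longrightarrow> (\<lambda>j. x j + y j) \<in> L"
  using diff[of x "\<lambda>j. (y j - y j) - y j"] diff[of "\<lambda>j. y j - y j" y] diff[of y y] by simp

lemma sum_in:
  assumes "finite I" "I \<noteq> {}" "\<And>i. i \<in> I \<Longrightarrow> f i \<in> L"
  shows "(\<lambda>j. \<Sum>i\<in>I. f i j) \<in> L"
  using assms by (induction I rule: finite_ne_induct) (simp_all add: add)

lemma layer_pos:
  assumes "x \<in> layer n" "1 \<le> n" "i \<in> S"
  shows "0 < x i"
proof (rule ccontr)
  assume "\<not> 0 < x i"
  then have "x i = 0" using layerD(2)[OF assms(1,3)] by simp
  then have "x j = 0" if "j \<in> S" for j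
    using zero_coord[of x i j] layerD[OF assms(1)] assms(3) that by blast
  then show False using layerD(4)[OF assms(1)] assms(2) by simp
qed

lemma layer_height_less:
  assumes "x \<in> layer n" "1 \<le> n"
  shows "n < card S"
proof -
  have "S \<noteq> {}" using layerD(4)[OF assms(1)] assms(2) by auto
  then have "(\<Sum>j\<in>S. x j) < (\<Sum>j\<in>S. 1)"
    using finite_S layerD(3)[OF assms(1)] by (intro sum_strict_mono) auto
  then show ?thesis using layerD(4)[OF assms(1)] by simp
qed

definition reflect :: "(nat \<Rightarrow> real) \<Rightarrow> nat \<Rightarrow> real" where
  "reflect x j = (if j \<in> S then 1 - x j else 0)"

text \<open>Positive height makes every coordinate on \<open>S\<close> positive, which keeps
  \<open>1 - x j\<close> below 1.\<close>

lemma reflect_layer: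
  assumes "x \<in> layer n" "1 \<le> n"
  shows "reflect x \<in> layer (card S - n)"
proof -
  have n: "n < card S" by (rule layer_height_less[OF assms])
  then have "S \<noteq> {}" by auto
  have "(\<lambda>j. (\<Sum>i\<in>S. if j = i then 1 else 0) - x j) \<in> L"
    by (intro diff sum_in finite_S \<open>S \<noteq> {}\<close> unit layerD(1)[OF assms(1)])
  also have "(\<lambda>j. (\<Sum>i\<in>S. if j = i then 1 else 0) - x j) = reflect x"
    using finite_S outside[OF layerD(1)[OF assms(1)]] by (auto simp: reflect_def)
  finally have "reflect x \<in> L" .
  moreover have "0 \<le> reflect x j \<and> reflect x j < 1" if "j \<in> S" for j
    using that layer_pos[OF assms that] layerD(3)[OF assms(1) that] by (simp add: reflect_def)
  moreover have "(\<Sum>j\<in>S. reflect x j) = real (card S - n)"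
    using n layerD(4)[OF assms(1)] by (simp add: reflect_def sum_subtractf)
  ultimately show ?thesis by (simp add: layer_def)
qed

lemma reflect_reflect: "x \<in> layer n \<Longrightarrow> reflect (reflect x) = x"
  using outside[OF layerD(1)] by (auto simp: reflect_def)

lemma card_layer_reflect:
  assumes "1 \<le> n" "n < card S"
  shows "card (layer (card S - n)) = card (layer n)"
  by (rule bij_betw_same_card[symmetric], rule bij_betw_byWitness[of _ reflect reflect])
    (use assms reflect_layer[of _ n] reflect_layer[of _ "card S - n"] reflect_reflect in auto)

end

lemma sum_lessThan_add: "(\<Sum>i<m+n. f i) = (\<Sum>i<m. f i) + (\<Sum>i<n. f (m + i))"
  for f :: "nat \<Rightarrow> real"
  by (induction n) simp_all

locale idp_box_lattice = box_lattice +
  assumes finite_layer: "finite (layer n)"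
    and idp: "1 \<le> n \<Longrightarrow> x \<in> layer n \<Longrightarrow> \<exists>y. (\<forall>i<n. y i \<in> layer 1) \<and> (\<forall>j. x j = (\<Sum>i<n. y i j))"
begin

lemma card_layer_mono:
  assumes k: "1 \<le> k" "2 * k < card S"
  shows "card (layer k) \<le> card (layer (Suc k))"
proof (rule ccontr)
  assume neg: "\<not> ?thesis"
  define s where "s = card S"
  \<comment> \<open>Since \<open>w + s = 2 * (s - k)\<close>, twice a point of height
    \<open>s - k\<close> splits into \<open>w + s\<close> points of height 1. By
    \<open>1 \<le> w\<close> one of them can be matched with the linear form.\<close>
  define w where "w = s - 2 * k"
  have s: "1 \<le> w" "s = w + 2 * k" using k by (auto simp: w_def s_def)
  define r where "r = card (layer 1)"
  obtain g where g: "bij_betw g {..<r} (layer 1)"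
    using ex_bij_betw_nat_finite[OF finite_layer] by (auto simp: r_def atLeast0LessThan)
  have g_layer: "g l \<in> layer 1" if "l < r" for l using g that by (auto simp: bij_betw_def)
  have ex_index: "\<exists>l<r. g l = x" if "x \<in> layer 1" for x
    using g that unfolding bij_betw_def by (metis imageE lessThan_iff)
  interpret expansion S r g
    by standard (auto simp: finite_S dest: g_layer layerD(2))
  \<comment> \<open>By reflection, layer \<open>s - Suc k\<close> is as large as layer
    \<open>Suc k\<close>. There are thus fewer test points \<open>y\<close> than unknowns
    \<open>u x\<close>.\<close>
  have "card (layer (s - Suc k)) < card (layer k)"
    using neg card_layer_reflect[of "Suc k"] k by (simp add: s_def)
  then obtain u where u_nz: "\<exists>x\<in>layer k. u x \<noteq> 0"
    and u_sol: "\<And>y. y \<in> layer (s - Suc k) \<Longrightarrow> (\<Sum>x\<in>layer k. u x *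
      (\<Sum>l<r. fps_const (indet (cvar l)) * T (\<lambda>j. x j + y j + g l j))) = 0"
    using homogeneous_system_solution[OF finite_layer finite_layer, of "s - Suc k" k
      "\<lambda>x y. \<Sum>l<r. fps_const (indet (cvar l)) * T (\<lambda>j. x j + y j + g l j)"] by blast
  \<comment> \<open>\<open>E y\<close> is the residue of \<open>u * l * x\<^sup>y\<close> for the generic linear form \<open>l\<close>. The relations \<open>u_sol\<close>
    concern box points \<open>y\<close> only; they extend to all lattice points because replacing a unit vector by
    \<open>\<Sum>k. a\<^sub>i\<^sub>k x\<^sup>g\<close> raises the \<open>fps_X\<close>-adic order.\<close>
  define E where "E y = (\<Sum>x\<in>layer k. u x *
      (\<Sum>l<r. fps_const (indet (cvar l)) * T (\<lambda>j. x j + y j + g l j)))" for y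
  have E_step: "E y = 0 \<or> (\<exists>i\<in>S. \<exists>y'\<in>L. (\<forall>j\<in>S. 0 \<le> y' j) \<and> (\<Sum>j\<in>S. y' j) + 1 = real (s - Suc k) \<and>
      E y = fps_X * (\<Sum>l<r. fps_const (indet (avar i l)) * E (\<lambda>j. y' j + g l j)))"
    if y: "y \<in> L" "\<And>j. j \<in> S \<Longrightarrow> 0 \<le> y j" "(\<Sum>j\<in>S. y j) = real (s - Suc k)" for y
  proof (cases "\<forall>j\<in>S. y j < 1")
    case True
    then have "y \<in> layer (s - Suc k)" using y by (auto simp: layer_def)
    then show ?thesis using u_sol by (simp add: E_def)
  next
    case False
    then obtain i where i: "i \<in> S" "1 \<le> y i" by force
    define y' where "y' j = y j - (if j = i then 1 else 0)" for j
    have y': "y' \<in> L" "\<forall>j\<in>S. 0 \<le> y' j" "(\<Sum>j\<in>S. y' j) + 1 = real (s - Suc k)"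
      using y i finite_S diff[OF y(1) unit[OF i(1)]] by (auto simp: y'_def[abs_def] sum_subtractf)
    have step: "T (\<lambda>j. x j + y j + g l j)
        = (\<Sum>l'<r. fps_const (indet (avar i l')) * fps_X * T (\<lambda>j. x j + (y' j + g l' j) + g l j))"
      if x: "x \<in> layer k" and l: "l < r" for x l
    proof -
      \<comment> \<open>The points of layer \<open>k \<ge> 1\<close> are interior, which gives the
        positivity that \<open>T_step\<close> requires.\<close>
      have "0 < x i + y' i + g l i"
        using layer_pos[OF x k(1) i(1)] y'(2) i(1) g_nonneg[OF l i(1)] by (simp add: add_pos_nonneg)
      from T_step[where q = "\<lambda>j. x j + y' j + g l j", OF i(1) this,
          of "\<lambda>j. x j + y j + g l j"]
      show ?thesis by (simp add: y'_def add_ac)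
    qed
    have "E y = (\<Sum>x\<in>layer k. \<Sum>l<r. \<Sum>l'<r. u x * (fps_const (indet (cvar l)) *
        (fps_const (indet (avar i l')) * fps_X * T (\<lambda>j. x j + (y' j + g l' j) + g l j))))"
      unfolding E_def sum_distrib_left
      by (intro sum.cong refl) (simp only: step lessThan_iff sum_distrib_left)
    also have "\<dots> = (\<Sum>x\<in>layer k. \<Sum>l'<r. \<Sum>l<r. u x * (fps_const (indet (cvar l)) *
        (fps_const (indet (avar i l')) * fps_X * T (\<lambda>j. x j + (y' j + g l' j) + g l j))))"
      by (rule sum.cong[OF refl], rule sum.swap)
    also have "\<dots> = (\<Sum>l'<r. \<Sum>x\<in>layer k. \<Sum>l<r. u x * (fps_const (indet (cvar l)) *
        (fps_const (indet (avar i l')) * fps_X * T (\<lambda>j. x j + (y' j + g l' j) + g l j))))"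
      by (rule sum.swap)
    also have "\<dots> = fps_X * (\<Sum>l'<r. fps_const (indet (avar i l')) * E (\<lambda>j. y' j + g l' j))"
      unfolding E_def sum_distrib_left by (intro sum.cong refl) (simp only: mult_ac)
    finally show ?thesis using i(1) y' by blast
  qed
  have E_nth: "E y $ n = 0"
    if "y \<in> L" "\<And>j. j \<in> S \<Longrightarrow> 0 \<le> y j" "(\<Sum>j\<in>S. y j) = real (s - Suc k)" for y n
    using that
  proof (induction n arbitrary: y)
    case (0 y)
    show ?case using E_step[OF 0] by auto
  next
    case (Suc n y)
    from E_step[OF Suc.prems] show ?case
    proof
      assume "\<exists>i\<in>S. \<exists>y'\<in>L. (\<forall>j\<in>S. 0 \<le> y' j) \<and> (\<Sum>j\<in>S. y' j) + 1 = real (s - Suc k) \<and>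
        E y = fps_X * (\<Sum>l<r. fps_const (indet (avar i l)) * E (\<lambda>j. y' j + g l j))"
      then obtain i y' where y': "i \<in> S" "y' \<in> L" "\<forall>j\<in>S. 0 \<le> y' j" "(\<Sum>j\<in>S. y' j) + 1 = real (s - Suc k)"
        "E y = fps_X * (\<Sum>l<r. fps_const (indet (avar i l)) * E (\<lambda>j. y' j + g l j))" by blast
      have "E (\<lambda>j. y' j + g l j) $ n = 0" if "l < r" for l
        using Suc.IH[of "\<lambda>j. y' j + g l j"] y'(2-4) layerD[OF g_layer[OF that]]
        by (simp add: add sum.distrib)
      then show ?thesis by (simp add: y'(5) fps_sum_nth)
    next
      assume "E y = 0"
      then show ?thesis by (simp only: fps_zero_nth)
    qed
  qed
  have E_zero: "E y = 0"
    if "y \<in> L" "\<And>j. j \<in> S \<Longrightarrow> 0 \<le> y j" "(\<Sum>j\<in>S. y j) = real (s - Suc k)" for y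
    by (rule fps_ext) (simp add: E_nth[OF that])
  \<comment> \<open>The residue of \<open>l * u\<^sup>2 * x\<^sup>v\<close> vanishes. In characteristic 2 it has no mixed terms, and its component
    at \<open>expo p\<close> and \<open>cvar l0\<close> is the residue of \<open>u * x\<^sup>\<rho>\<close>.\<close>
  have half: "(\<Sum>x\<in>layer k. u x * T (\<lambda>j. x j + \<rho> j)) = 0"
    if z: "\<And>i. i < w \<Longrightarrow> z i \<in> layer 1" and p: "p \<in> S \<rightarrow> {..<r}"
      and \<rho>: "\<And>j. j \<in> S \<Longrightarrow> (\<Sum>i<w. z i j) + (\<Sum>i\<in>S. g (p i) j) = 2 * \<rho> j"
    for z p \<rho>
  proof -
    \<comment> \<open>\<open>z 0\<close> is reserved for the term of the linear form picked out by
      \<open>cvar l0\<close>; the other \<open>w - 1\<close> points make up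
      \<open>v\<close>.\<close>
    define v where "v j = (\<Sum>i<w-1. z (Suc i) j)" for j
    have w: "{..<w} = {..<Suc (w - 1)}" using s(1) by simp
    have z_sum: "(\<Sum>i<w. z i j) = z 0 j + v j" for j
      unfolding w sum.lessThan_Suc_shift v_def ..
    obtain l0 where l0: "l0 < r" "g l0 = z 0" using ex_index z s(1) by (metis less_le_trans zero_less_one)
    have v: "(\<lambda>j. x j + v j) \<in> L" "\<And>j. j \<in> S \<Longrightarrow> 0 \<le> x j + v j"
      "(\<Sum>j\<in>S. x j + v j) = real (s - Suc k)" if x: "x \<in> layer k" for x
    proof -
      have z': "z (Suc i) \<in> layer 1" if "i < w - 1" for i using z[of "Suc i"] that by simp
      show "(\<lambda>j. x j + v j) \<in> L"
      proof (cases "w = 1")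
        case True
        then show ?thesis using layerD(1)[OF x] by (simp add: v_def)
      next
        case False
        then have "0 \<in> {..<w-1}" using s(1) by simp
        then have "{..<w-1} \<noteq> {}" by blast
        then show ?thesis unfolding v_def
          by (intro add layerD(1)[OF x] sum_in) (auto intro: layerD(1)[OF z'])
      qed
      show "0 \<le> x j + v j" if "j \<in> S" for j
        unfolding v_def by (intro add_nonneg_nonneg sum_nonneg) (use that layerD(2)[OF x] layerD(2)[OF z'] in auto)
      have "(\<Sum>j\<in>S. v j) = (\<Sum>i<w-1. 1)"
        unfolding v_def by (subst sum.swap, intro sum.cong refl) (use layerD(4)[OF z'] in simp)
      then show "(\<Sum>j\<in>S. x j + v j) = real (s - Suc k)"
        using s layerD(4)[OF x] by (simp add: sum.distrib)
    qed
    define F where "F x x' = u x * u x' * (\<Sum>l<r. fps_const (indet (cvar l)) * T (\<lambda>j. x j + x' j + v j + g l j))" for x x'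
    have "E (\<lambda>j. x j + v j) = 0" if "x \<in> layer k" for x
      by (rule E_zero) (use v[OF that] in auto)
    then have "0 = (\<Sum>x'\<in>layer k. u x' * E (\<lambda>j. x' j + v j))" by simp
    also have "\<dots> = (\<Sum>x'\<in>layer k. \<Sum>x\<in>layer k. F x' x)"
      unfolding E_def F_def sum_distrib_left[of "u _" _ "layer k"]
      by (intro sum.cong refl) (simp only: mult_ac add_ac)
    also have "\<dots> = (\<Sum>x\<in>layer k. F x x)"
    proof (rule sum_symmetric_char2)
      show "F x x' = F x' x" for x x'
        unfolding F_def mult.commute[of "u x"] add.commute[of "x _"] ..
    qed (simp_all add: finite_layer)
    also have "\<dots> = (\<Sum>x\<in>layer k. \<Sum>l<r. u x * u x * (fps_const (indet (cvar l)) * T (\<lambda>j. x j + x j + v j + g l j)))"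
      by (simp only: F_def sum_distrib_left)
    finally have "0 = sqpart_fps (expo p + single (cvar l0) 1) (card S) \<dots>" by simp
    also have "\<dots> = (\<Sum>x\<in>layer k. \<Sum>l<r. if l = l0 then u x * T (\<lambda>j. x j + \<rho> j) else 0)"
      unfolding sqpart_fps_sum
    proof (intro sum.cong refl)
      fix x l assume "x \<in> layer k" "l \<in> {..<r}"
      \<comment> \<open>Half of the total exponent, possibly off the lattice. It equals
        \<open>x + \<rho>\<close> on \<open>S\<close> when \<open>l = l0\<close>; the other terms
        are killed by \<open>cvar l0\<close>.\<close>
      define q' where "q' j = (x j + x j + v j + g l j + (\<Sum>i\<in>S. g (p i) j)) / 2" for j
      have "l = l0 \<Longrightarrow> T q' = T (\<lambda>j. x j + \<rho> j)"
        using \<rho> by (intro T_cong) (simp add: q'_def z_sum l0(2) add_ac)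
      then show "sqpart_fps (expo p + single (cvar l0) 1) (card S)
          (u x * u x * (fps_const (indet (cvar l)) * T (\<lambda>j. x j + x j + v j + g l j)))
        = (if l = l0 then u x * T (\<lambda>j. x j + \<rho> j) else 0)"
        by (subst sqpart_cvar_T[OF p, of _ q']) (simp_all add: q'_def)
    qed
    also have "\<dots> = (\<Sum>x\<in>layer k. u x * T (\<lambda>j. x j + \<rho> j))"
      using l0(1) by simp
    finally show ?thesis by simp
  qed
  have vanish: "(\<Sum>x\<in>layer k. u x * T (\<lambda>j. x j + \<rho> j)) = 0" if \<rho>: "\<rho> \<in> layer (s - k)" for \<rho>
  proof -
    define n where "n = s - k"
    have n: "1 \<le> n" "n + n = w + s" using s k(1) by (auto simp: n_def)
    obtain y where y: "\<And>i. i < n \<Longrightarrow> y i \<in> layer 1" "\<And>j. \<rho> j = (\<Sum>i<n. y i j)"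
      using idp[OF n(1), of \<rho>] \<rho> by (auto simp: n_def)
    \<comment> \<open>The decomposition of \<open>\<rho>\<close> listed twice, giving
      \<open>n + n = w + s\<close> points with sum \<open>2 * \<rho>\<close>.\<close>
    define z where "z i = y (if i < n then i else i - n)" for i
    have z: "z i \<in> layer 1" if "i < w + s" for i
      unfolding z_def by (rule y(1)) (use that n(2) in auto)
    have z_sum: "(\<Sum>i<w. z i j) + (\<Sum>i<s. z (w + i) j) = 2 * \<rho> j" for j
    proof -
      have "(\<Sum>i<w. z i j) + (\<Sum>i<s. z (w + i) j) = (\<Sum>i<n+n. z i j)"
        by (simp only: n(2) sum_lessThan_add)
      also have "\<dots> = 2 * \<rho> j"
        unfolding sum_lessThan_add by (simp add: z_def y(2))
      finally show ?thesis .
    qed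
    \<comment> \<open>The last \<open>s\<close> points are distributed over the \<open>s\<close>
      parameters, which determines \<open>p\<close>.\<close>
    obtain h where h: "bij_betw h S {..<s}"
      using ex_bij_betw_finite_nat[OF finite_S] by (auto simp: s_def atLeast0LessThan)
    have "\<forall>i\<in>S. \<exists>l<r. g l = z (w + h i)"
    proof
      fix i assume "i \<in> S"
      then have "h i < s" using h by (auto simp: bij_betw_def)
      then show "\<exists>l<r. g l = z (w + h i)" by (intro ex_index z) simp
    qed
    then obtain p where p: "\<And>i. i \<in> S \<Longrightarrow> p i < r \<and> g (p i) = z (w + h i)" by metis
    have "(\<Sum>i\<in>S. g (p i) j) = (\<Sum>i<s. z (w + i) j)" for j
      using p sum.reindex_bij_betw[OF h, of "\<lambda>i. z (w + i) j"] by simp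
    then show ?thesis
      using p z z_sum by (intro half[of z p]) auto
  qed
  \<comment> \<open>At lowest order the pairing of opposite layers is the permutation matrix of \<open>reflect\<close>.\<close>
  define n where "n = (LEAST n. \<exists>x\<in>layer k. u x $ n \<noteq> 0)"
  have "\<exists>n. \<exists>x\<in>layer k. u x $ n \<noteq> 0" using u_nz by (metis fps_nonzero_nth)
  then have "\<exists>x\<in>layer k. u x $ n \<noteq> 0" unfolding n_def by (rule LeastI_ex)
  then obtain x0 where x0: "x0 \<in> layer k" "u x0 $ n \<noteq> 0" by blast
  have low: "u x $ i = 0" if "i < n" "x \<in> layer k" for i x
    using not_less_Least[OF that(1)[unfolded n_def]] that(2) by blast
  have "0 = (\<Sum>x\<in>layer k. u x * T (\<lambda>j. x j + reflect x0 j)) $ n"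
    using vanish[OF reflect_layer[OF x0(1) k(1), folded s_def]] by simp
  also have "\<dots> = (\<Sum>x\<in>layer k. if x = x0 then u x0 $ n else 0)"
    unfolding fps_sum_nth
  proof (rule sum.cong[OF refl])
    fix x assume x: "x \<in> layer k"
    have "(u x * T (\<lambda>j. x j + reflect x0 j)) $ n
        = (\<Sum>i=0..n. if i = n then u x $ n * T (\<lambda>j. x j + reflect x0 j) $ 0 else 0)"
      unfolding fps_mult_nth by (rule sum.cong[OF refl]) (use low[OF _ x] in auto)
    also have "\<dots> = u x $ n * T (\<lambda>j. x j + reflect x0 j) $ 0" by simp
    also have "(\<forall>j\<in>S. x j + reflect x0 j = 1) \<longleftrightarrow> x = x0"
    proof
      assume eq: "\<forall>j\<in>S. x j + reflect x0 j = 1"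
      show "x = x0"
      proof
        fix j show "x j = x0 j"
          using eq outside[OF layerD(1)[OF x], of j] outside[OF layerD(1)[OF x0(1)], of j]
          by (cases "j \<in> S") (auto simp: reflect_def)
      qed
    qed (simp add: reflect_def)
    then have "T (\<lambda>j. x j + reflect x0 j) $ 0 = (if x = x0 then 1 else 0)"
      by (simp only: T_constant)
    finally show "(u x * T (\<lambda>j. x j + reflect x0 j)) $ n = (if x = x0 then u x0 $ n else 0)" by simp
  qed
  also have "\<dots> = u x0 $ n" using x0(1) finite_layer by simp
  finally show False using x0(2) by simp
qed

end

section \<open>Lattice points of dilated simplices\<close>

locale coordinate_simplex =
  fixes M :: "'a::euclidean_space set" and v :: "nat \<Rightarrow> 'a" and d :: nat
  assumes lattice: "is_lattice M"
    and inj_v: "inj_on v {..d}"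
    and indep: "\<not> affine_dependent (v ` {..d})"
    and vertex: "j \<le> d \<Longrightarrow> v j \<in> M"
begin

abbreviation \<Delta> :: "'a set" where "\<Delta> \<equiv> convex hull (v ` {..d})"

definition pt :: "(nat \<Rightarrow> real) \<Rightarrow> 'a" where "pt x = (\<Sum>j\<le>d. x j *\<^sub>R v j)"

text \<open>The cone lattice in the coordinates given by \<open>W\<close>. Functions are extended by
  0 rather than \<open>undefined\<close>, so that pointwise sums and differences stay
  inside.\<close>

definition coord_lattice :: "(nat \<Rightarrow> real) set" where
  "coord_lattice = {x. (\<forall>j>d. x j = 0) \<and> pt x \<in> M \<and> (\<Sum>j\<le>d. x j) \<in> \<int>}"

text \<open>Interpolates between the lattice points of the \<open>n\<close>-th dilate
  (\<open>J = {}\<close>) and the box points of height \<open>n\<close>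
  (\<open>J = {..d}\<close>).\<close>

definition cells :: "nat set \<Rightarrow> nat \<Rightarrow> (nat \<Rightarrow> real) set" where
  "cells J n = {x \<in> coord_lattice. (\<forall>j\<le>d. 0 \<le> x j) \<and> (\<forall>j\<in>J. x j < 1) \<and> (\<Sum>j\<le>d. x j) = real n}"

lemma pt_eq:
  assumes "pt x = pt y" "(\<Sum>j\<le>d. x j) = (\<Sum>j\<le>d. y j)" "j \<le> d"
  shows "x j = y j"
proof (rule ccontr)
  assume neq: "x j \<noteq> y j"
  define u where "u p = x (inv_into {..d} v p) - y (inv_into {..d} v p)" for p
  have u: "u (v i) = x i - y i" if "i \<le> d" for i
    using that inj_v by (simp add: u_def)
  have "sum u (v ` {..d}) = 0"
    using inj_v assms(2) by (simp add: sum.reindex u sum_subtractf)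
  moreover have "(\<Sum>p\<in>v ` {..d}. u p *\<^sub>R p) = 0"
    using inj_v assms(1) by (simp add: sum.reindex u scaleR_left_diff_distrib sum_subtractf pt_def)
  moreover have "\<exists>p\<in>v ` {..d}. u p \<noteq> 0" using u neq assms(3) by auto
  ultimately have "affine_dependent (v ` {..d})"
    unfolding affine_dependent_explicit_finite[OF finite_imageI[OF finite_atMost]] by blast
  with indep show False ..
qed

lemma hull_eq: "\<Delta> = {pt u |u. (\<forall>j\<le>d. 0 \<le> u j) \<and> (\<Sum>j\<le>d. u j) = 1}"
proof (intro equalityI subsetI)
  fix z assume "z \<in> \<Delta>"
  then obtain u where "\<forall>p\<in>v ` {..d}. 0 \<le> u p" "sum u (v ` {..d}) = 1" "(\<Sum>p\<in>v ` {..d}. u p *\<^sub>R p) = z"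
    by (auto simp: convex_hull_finite)
  then show "z \<in> {pt u |u. (\<forall>j\<le>d. 0 \<le> u j) \<and> (\<Sum>j\<le>d. u j) = 1}"
    using inj_v by (auto simp: sum.reindex pt_def intro!: exI[of _ "u \<circ> v"])
next
  fix z assume "z \<in> {pt u |u. (\<forall>j\<le>d. 0 \<le> u j) \<and> (\<Sum>j\<le>d. u j) = 1}"
  then obtain u where u: "z = pt u" "\<forall>j\<le>d. 0 \<le> u j" "(\<Sum>j\<le>d. u j) = 1" by blast
  show "z \<in> \<Delta>"
    unfolding u(1) pt_def
    by (rule convex_sum[OF finite_atMost convex_convex_hull]) (use u in \<open>auto simp: hull_inc\<close>)
qed

lemma pt_scale: "pt (\<lambda>j. c * x j) = c *\<^sub>R pt x"
  by (simp add: pt_def scaleR_sum_right)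

lemma pt_add: "pt (\<lambda>j. x j + y j) = pt x + pt y"
  by (simp add: pt_def scaleR_left_distrib sum.distrib)

lemma pt_diff: "pt (\<lambda>j. x j - y j) = pt x - pt y"
  by (simp add: pt_def scaleR_left_diff_distrib sum_subtractf)

lemma pt_unit: "i \<le> d \<Longrightarrow> pt (\<lambda>j. if j = i then 1 else 0) = v i"
  by (simp add: pt_def if_distrib[of "\<lambda>c. c *\<^sub>R _"] cong: if_cong)

lemma pt_cong: "(\<And>j. j \<le> d \<Longrightarrow> x j = y j) \<Longrightarrow> pt x = pt y"
  by (simp add: pt_def)

lemma coord_diff: "x \<in> coord_lattice \<Longrightarrow> y \<in> coord_lattice \<Longrightarrow> (\<lambda>j. x j - y j) \<in> coord_lattice"
  by (simp add: coord_lattice_def pt_diff lattice_arith(2)[OF lattice] sum_subtractf)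

lemma coord_unit: "i \<le> d \<Longrightarrow> (\<lambda>j. if j = i then 1 else 0) \<in> coord_lattice"
  by (auto simp: coord_lattice_def pt_unit vertex)

lemma coord_add:
  assumes "x \<in> coord_lattice" "y \<in> coord_lattice"
  shows "(\<lambda>j. x j + y j) \<in> coord_lattice"
  using coord_diff[OF assms(1) coord_diff[OF coord_diff[OF assms(2,2)] assms(2)]] by simp

section \<open>Lattice points of dilates in barycentric coordinates\<close>

lemma bij_betw_cells: "bij_betw pt (cells {} n) (dilate n \<Delta> \<inter> M)"
  unfolding bij_betw_def
proof
  show "inj_on pt (cells {} n)"
  proof (rule inj_onI)
    fix x y assume xy: "x \<in> cells {} n" "y \<in> cells {} n" "pt x = pt y"
    show "x = y"
    proof
      fix j show "x j = y j"
        using pt_eq[OF xy(3), of j] xy(1,2) by (cases "j \<le> d") (auto simp: cells_def coord_lattice_def)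
    qed
  qed
  show "pt ` cells {} n = dilate n \<Delta> \<inter> M"
  proof (intro equalityI subsetI)
    fix z assume "z \<in> pt ` cells {} n"
    then obtain x where x: "x \<in> cells {} n" "z = pt x" by blast
    have "z \<in> dilate n \<Delta>"
    proof (cases "n = 0")
      \<comment> \<open>Dividing by \<open>n\<close> is impossible here; the only point is the
        origin.\<close>
      case True
      then have "(\<Sum>j\<le>d. x j) = 0" "\<forall>j\<le>d. 0 \<le> x j" using x(1) by (auto simp: cells_def)
      then have "\<forall>j\<le>d. x j = 0" using sum_nonneg_eq_0_iff[of "{..d}" x] by auto
      then have "z = 0" by (simp add: x(2) pt_def)
      moreover have "v 0 \<in> \<Delta>" by (simp add: hull_inc)
      ultimately show ?thesis using True by (force simp: dilate_def)
    next
      case False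
      then have "pt (\<lambda>j. (1 / real n) * x j) \<in> \<Delta>"
        using x(1) unfolding hull_eq by (auto simp: cells_def simp flip: sum_divide_distrib intro!: exI[of _ "\<lambda>j. x j / real n"])
      moreover have "z = real n *\<^sub>R pt (\<lambda>j. (1 / real n) * x j)"
        unfolding pt_scale x(2) using False by simp
      ultimately show ?thesis unfolding dilate_def by blast
    qed
    moreover have "z \<in> M" using x by (auto simp: cells_def coord_lattice_def)
    ultimately show "z \<in> dilate n \<Delta> \<inter> M" by blast
  next
    fix z assume z: "z \<in> dilate n \<Delta> \<inter> M"
    then obtain u where u: "z = real n *\<^sub>R pt u" "\<forall>j\<le>d. 0 \<le> u j" "(\<Sum>j\<le>d. u j) = 1"
      unfolding dilate_def hull_eq by auto
    define x where "x j = (if j \<le> d then real n * u j else 0)" for j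
    have "pt x = z" unfolding u(1) pt_scale[symmetric] by (rule pt_cong) (simp add: x_def)
    moreover have "(\<Sum>j\<le>d. x j) = real n"
      using u(3) by (simp add: x_def flip: sum_distrib_left)
    ultimately have "x \<in> cells {} n"
      using z u(2) by (auto simp: cells_def coord_lattice_def x_def)
    then show "z \<in> pt ` cells {} n" using \<open>pt x = z\<close> by blast
  qed
qed

abbreviation shift :: "nat \<Rightarrow> (nat \<Rightarrow> real) \<Rightarrow> nat \<Rightarrow> real" where
  "shift i x \<equiv> \<lambda>j. x j + (if j = i then 1 else 0)"

text \<open>Either the \<open>i\<close>-th coordinate is below 1, or the \<open>i\<close>-th unit
  vector can be subtracted. For generating functions this is multiplication by
  \<open>1 - fps_X\<close>.\<close>

lemma cells_step:
  assumes i: "i \<le> d" "i \<notin> J"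
  shows "cells J n = cells (insert i J) n \<union> (if n = 0 then {} else shift i ` cells J (n - 1))"
    "cells (insert i J) n \<inter> shift i ` cells J m = {}"
proof -
  show "cells (insert i J) n \<inter> shift i ` cells J m = {}"
    using i by (auto simp: cells_def)
  have down: "x \<in> shift i ` cells J (n - 1) \<and> n \<noteq> 0" if x: "x \<in> cells J n" "\<not> x i < 1" for x
  proof -
    define y where "y j = x j - (if j = i then 1 else 0)" for j
    have "1 \<le> (\<Sum>j\<le>d. x j)"
      using x i member_le_sum[of i "{..d}" x] by (auto simp: cells_def)
    then have n: "n \<noteq> 0" using x by (auto simp: cells_def)
    have "y \<in> coord_lattice" using x coord_diff[OF _ coord_unit[OF i(1)]] by (simp add: cells_def y_def[abs_def])
    moreover have "(\<Sum>j\<le>d. y j) = real (n - 1)" using x n i by (simp add: y_def sum_subtractf cells_def of_nat_diff)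
    ultimately have "y \<in> cells J (n - 1)" using x i by (auto simp: cells_def y_def)
    moreover have "x = shift i y" by (auto simp: y_def)
    ultimately show ?thesis using n by blast
  qed
  have up: "shift i y \<in> cells J n" if "y \<in> cells J (n - 1)" "n \<noteq> 0" for y
    using that i coord_add[OF _ coord_unit[OF i(1)], of y]
    by (auto simp: cells_def sum.distrib of_nat_diff add_nonneg_nonneg)
  show "cells J n = cells (insert i J) n \<union> (if n = 0 then {} else shift i ` cells J (n - 1))"
  proof (intro equalityI subsetI)
    fix x assume x: "x \<in> cells J n"
    show "x \<in> cells (insert i J) n \<union> (if n = 0 then {} else shift i ` cells J (n - 1))"
    proof (cases "x i < 1")
      case True
      then show ?thesis using x by (simp add: cells_def)
    next
      case False
      then show ?thesis using down[OF x] by simp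
    qed
  next
    fix x assume "x \<in> cells (insert i J) n \<union> (if n = 0 then {} else shift i ` cells J (n - 1))"
    then have "x \<in> cells (insert i J) n \<or> (\<exists>y\<in>cells J (n - 1). n \<noteq> 0 \<and> x = shift i y)"
      by (auto split: if_splits)
    then show "x \<in> cells J n"
    proof
      assume "x \<in> cells (insert i J) n"
      then show ?thesis by (simp add: cells_def)
    qed (use up in blast)
  qed
qed

lemma inj_shift: "inj_on (shift i) A"
proof (rule inj_onI)
  fix x y assume "shift i x = shift i y"
  from fun_cong[OF this] show "x = y" by (intro ext) simp
qed

section \<open>Generating functions and the \<open>h\<^sup>*\<close>-polynomial\<close>

definition ht_series :: "nat set \<Rightarrow> int fps" where
  "ht_series J = Abs_fps (\<lambda>n. int (card (cells J n)))"

context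
  assumes fin: "\<And>n. finite (cells {..d} n)"
begin

text \<open>The coordinates are freed one at a time, starting from the finite box;
  \<open>cells_step\<close> leads either to one more bounded coordinate or to smaller
  height.\<close>

lemma finite_cells: "J \<subseteq> {..d} \<Longrightarrow> finite (cells J n)"
proof (induction n arbitrary: J rule: less_induct)
  case (less n)
  have "finite (cells ({..d} - K) n)" if "finite K" "K \<subseteq> {..d}" for K
    using that
  proof (induction K rule: finite_induct)
    case empty
    show ?case using fin by simp
  next
    case (insert i K)
    have i: "i \<le> d" "i \<notin> {..d} - insert i K" using insert.prems by auto
    have "insert i ({..d} - insert i K) = {..d} - K" using insert.prems insert.hyps by auto
    then have "finite (cells (insert i ({..d} - insert i K)) n)" using insert by simp
    then show ?case
      by (subst cells_step(1)[OF i]) (use less.IH[of "n - 1" "{..d} - insert i K"] in auto)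
  qed
  from this[of "{..d} - J"] show ?case using less.prems by (simp add: double_diff)
qed

lemma ht_series_step:
  assumes i: "i \<le> d" "i \<notin> J" and J: "J \<subseteq> {..d}"
  shows "(1 - fps_X) * ht_series J = ht_series (insert i J)"
proof (rule fps_ext)
  fix n
  have "card (cells J n) = card (cells (insert i J) n) + (if n = 0 then 0 else card (cells J (n - 1)))"
  proof (subst cells_step(1)[OF i], subst card_Un_disjoint)
    show "cells (insert i J) n \<inter> (if n = 0 then {} else shift i ` cells J (n - 1)) = {}"
      using cells_step(2)[OF i] by simp
  qed (use finite_cells J i in \<open>auto simp: card_image[OF inj_shift]\<close>)
  then show "((1 - fps_X) * ht_series J) $ n = ht_series (insert i J) $ n"
    by (simp add: ht_series_def left_diff_distrib)
qed

lemma ehrhart_series_eq: "ehrhart_series M \<Delta> * (1 - fps_X) ^ (d + 1) = ht_series {..d}"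
proof -
  have "(1 - fps_X) ^ card J * ht_series {} = ht_series J" if "finite J" "J \<subseteq> {..d}" for J
    using that
  proof (induction J rule: finite_induct)
    case (insert i J)
    then show ?case using ht_series_step[of i J] by (simp add: mult.assoc)
  qed simp
  from this[of "{..d}"] have "(1 - fps_X) ^ (d + 1) * ht_series {} = ht_series {..d}" by simp
  moreover have "ehrhart_series M \<Delta> = ht_series {}"
    unfolding ehrhart_series_def ht_series_def using bij_betw_same_card[OF bij_betw_cells] by simp
  ultimately show ?thesis by (simp only: mult.commute)
qed

lemma coeff_hstar_poly:
  "coeff (hstar_poly M \<Delta>) n = int (card (cells {..d} n))"
proof -
  define h where "h = (\<Sum>n\<le>d. Polynomial.monom (int (card (cells {..d} n))) n)"
  \<comment> \<open>A sum of \<open>d + 1\<close> coordinates below 1 is below \<open>d + 1\<close>;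
    this bounds the degree of \<open>h\<close>.\<close>
  have "cells {..d} n = {}" if "n > d" for n
  proof (rule equals0I)
    fix x assume "x \<in> cells {..d} n"
    then have "(\<Sum>j\<le>d. x j) = real n" "\<forall>j\<le>d. x j < 1" by (auto simp: cells_def)
    moreover have "(\<Sum>j\<le>d. x j) < (\<Sum>j\<le>d. 1)"
      using \<open>\<forall>j\<le>d. x j < 1\<close> by (intro sum_strict_mono) auto
    ultimately show False using that by simp
  qed
  then have coeff_h: "coeff h n = int (card (cells {..d} n))" for n
    by (cases "n \<le> d") (simp_all add: h_def coeff_sum if_distrib cong: if_cong)
  have dim: "nat (aff_dim \<Delta>) = d"
    using aff_dim_affine_independent[OF indep] inj_v by (simp add: aff_dim_convex_hull card_image)
  have h: "ehrhart_series M \<Delta> * (1 - fps_X) ^ (d + 1) = fps_of_poly h"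
    unfolding ehrhart_series_eq by (rule fps_ext) (simp add: ht_series_def coeff_h)
  have "degree h \<le> d"
    unfolding h_def by (intro degree_sum_le) (auto intro: order_trans[OF degree_monom_le])
  then have "hstar_poly M \<Delta> = h"
    unfolding hstar_poly_def dim h by (intro the_equality) (simp_all add: fps_of_poly_eq_iff)
  then show ?thesis by (simp add: coeff_h)
qed

end

text \<open>The summands have nonnegative coordinates, so each is bounded coordinatewise by
  \<open>x\<close> and stays in the box.\<close>

lemma idp_cells:
  assumes idp: "IDP M \<Delta>" and n: "1 \<le> n" and x: "x \<in> cells {..d} n"
  shows "\<exists>y. (\<forall>i<n. y i \<in> cells {..d} 1) \<and> (\<forall>j. x j = (\<Sum>i<n. y i j))"
proof -
  have "x \<in> cells {} n" using x by (auto simp: cells_def)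
  then have "pt x \<in> dilate n \<Delta> \<inter> M" using bij_betw_cells by (auto simp: bij_betw_def)
  then obtain q where q: "\<And>i. i \<in> {1..n} \<Longrightarrow> q i \<in> \<Delta> \<inter> M" "pt x = (\<Sum>i=1..n. q i)"
    using idp n unfolding IDP_def by blast
  have "\<exists>y\<in>cells {} 1. q (Suc i) = pt y" if "i < n" for i
  proof -
    have "q (Suc i) \<in> dilate 1 \<Delta> \<inter> M" using q(1)[of "Suc i"] that by (simp add: dilate_def)
    then show ?thesis using bij_betw_cells[of 1] by (auto simp: bij_betw_def)
  qed
  then obtain y where y: "\<And>i. i < n \<Longrightarrow> y i \<in> cells {} 1 \<and> q (Suc i) = pt (y i)" by metis
  have pt_sum: "pt (\<lambda>j. \<Sum>i<m. y i j) = (\<Sum>i<m. pt (y i))" for m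
    by (induction m) (simp_all add: pt_add, simp add: pt_def)
  have "pt x = (\<Sum>i<n. q (Suc i))"
    unfolding q(2) by (rule sum.reindex_bij_witness[of _ Suc "\<lambda>i. i - 1"]) auto
  then have "pt x = pt (\<lambda>j. \<Sum>i<n. y i j)" using y by (simp add: pt_sum)
  moreover have "(\<Sum>j\<le>d. x j) = (\<Sum>j\<le>d. \<Sum>i<n. y i j)"
  proof -
    have "(\<Sum>j\<le>d. \<Sum>i<n. y i j) = (\<Sum>i<n. 1)"
      by (subst sum.swap, intro sum.cong refl) (use y in \<open>auto simp: cells_def\<close>)
    then show ?thesis using x by (simp add: cells_def)
  qed
  ultimately have eq: "x j = (\<Sum>i<n. y i j)" for j
    using pt_eq[of x "\<lambda>j. \<Sum>i<n. y i j" j] x y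
    by (cases "j \<le> d") (auto simp: cells_def coord_lattice_def)
  have "y i \<in> cells {..d} 1" if i: "i < n" for i
  proof -
    have "y i j < 1" if j: "j \<le> d" for j
    proof -
      have "y i j \<le> x j"
        unfolding eq by (rule member_le_sum) (use i j y in \<open>auto simp: cells_def\<close>)
      also have "\<dots> < 1" using x j by (auto simp: cells_def)
      finally show ?thesis .
    qed
    then show ?thesis using y[OF i] by (auto simp: cells_def)
  qed
  then show ?thesis using eq by blast
qed

section \<open>The coordinate group\<close>

lemma carrier_coord_group:
  "l \<in> carrier (coord_group M d v) \<longleftrightarrow>
    l \<in> {..d} \<rightarrow>\<^sub>E {0..<1} \<and> pt l \<in> M \<and> (\<Sum>j\<le>d. l j) \<in> \<int>"
proof -
  have W: "W_map d v l = (pt l, \<Sum>j\<le>d. l j)"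
    by (simp add: W_map_def pt_def prod_eq_iff fst_sum snd_sum)
  \<comment> \<open>The span condition is automatic, because all generators \<open>(v j, 1)\<close>
    lie in the cone.\<close>
  have "W_map d v l \<in> span (cone_over \<Delta>)"
    unfolding W_map_def
  proof (intro span_sum span_scale span_base)
    fix j assume "j \<in> {..d}"
    then have "(v j, 1) \<in> \<Delta> \<times> {1}" by (simp add: hull_inc)
    then show "(v j, 1) \<in> cone_over \<Delta>" unfolding cone_over_def by (rule hull_inc)
  qed
  then show ?thesis by (auto simp: coord_group_def cone_lattice_def W)
qed

lemma cells_carrier:
  "x \<in> coord_lattice \<Longrightarrow> (\<And>j. j \<le> d \<Longrightarrow> 0 \<le> x j \<and> x j < 1) \<Longrightarrow> restrict x {..d} \<in> carrier (coord_group M d v)"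
  using pt_cong[of "restrict x {..d}" x] by (auto simp: carrier_coord_group coord_lattice_def)

lemma finite_box_cells:
  assumes "finite (carrier (coord_group M d v))"
  shows "finite (cells {..d} n)"
proof (rule inj_on_finite[OF _ _ assms])
  show "inj_on (\<lambda>x. restrict x {..d}) (cells {..d} n)"
  proof (rule inj_onI)
    fix x y assume xy: "x \<in> cells {..d} n" "y \<in> cells {..d} n" "restrict x {..d} = restrict y {..d}"
    show "x = y"
    proof
      fix j show "x j = y j"
        using xy(1,2) fun_cong[OF xy(3), of j]
        by (cases "j \<le> d") (auto simp: cells_def coord_lattice_def)
    qed
  qed
  show "(\<lambda>x. restrict x {..d}) ` cells {..d} n \<subseteq> carrier (coord_group M d v)"
    by (auto intro!: cells_carrier simp: cells_def)
qed

text \<open>The group operation is addition modulo integers, so powers of \<open>g\<close> are its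
  multiples modulo integers. A negative power is reached through its inverse.\<close>

lemma cyclic_coordinates:
  assumes g: "g \<in> carrier (coord_group M d v)"
    and gen: "subgroup_generated (coord_group M d v) {g} = coord_group M d v"
    and l: "l \<in> carrier (coord_group M d v)"
  shows "\<exists>k::int. \<forall>j\<le>d. l j - of_int k * g j \<in> \<int>"
proof -
  interpret G: comm_group "coord_group M d v"
    by (rule comm_group_coord_group[OF lattice vertex])
  have mult: "(x \<otimes>\<^bsub>coord_group M d v\<^esub> y) j - (x j + y j) \<in> \<int>" if "j \<le> d" for x y j
    using that by (simp add: coord_group_def frac_def)
  have pow: "\<forall>j\<le>d. (g [^]\<^bsub>coord_group M d v\<^esub> n) j - real n * g j \<in> \<int>" for n :: nat
  proof (induction n)
    case 0
    then show ?case by (simp add: coord_group_def)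
  next
    case (Suc n)
    show ?case
    proof (intro allI impI)
      fix j assume j: "j \<le> d"
      let ?p = "g [^]\<^bsub>coord_group M d v\<^esub> n"
      have "((?p \<otimes>\<^bsub>coord_group M d v\<^esub> g) j - (?p j + g j)) + (?p j - real n * g j) \<in> \<int>"
        using mult[OF j] Suc j by (intro Ints_add) auto
      then show "(g [^]\<^bsub>coord_group M d v\<^esub> Suc n) j - real (Suc n) * g j \<in> \<int>"
        by (simp add: algebra_simps)
    qed
  qed
  obtain k :: int where k: "l = g [^]\<^bsub>coord_group M d v\<^esub> k"
    using l G.carrier_subgroup_generated_by_singleton[OF g] unfolding gen by blast
  show ?thesis
  proof (cases "0 \<le> k")
    case True
    then have "l = g [^]\<^bsub>coord_group M d v\<^esub> nat k" using int_pow_int[of _ g "nat k"] by (simp add: k)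
    then show ?thesis using pow[of "nat k"] True by (intro exI[of _ k]) simp
  next
    case False
    define n where "n = nat (- k)"
    have n: "k = - int n" using False by (simp add: n_def)
    have "l \<otimes>\<^bsub>coord_group M d v\<^esub> g [^]\<^bsub>coord_group M d v\<^esub> n = \<one>\<^bsub>coord_group M d v\<^esub>"
      unfolding k n using g by (simp add: G.int_pow_neg_int)
    then have *: "(l \<otimes>\<^bsub>coord_group M d v\<^esub> g [^]\<^bsub>coord_group M d v\<^esub> n) j = 0" if "j \<le> d" for j
      using that by (simp add: coord_group_def)
    show ?thesis
    proof (intro exI[of _ k] allI impI)
      fix j assume j: "j \<le> d"
      let ?p = "g [^]\<^bsub>coord_group M d v\<^esub> n"
      have "- ((l \<otimes>\<^bsub>coord_group M d v\<^esub> ?p) j - (l j + ?p j)) - (?p j - real n * g j) \<in> \<int>"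
        by (rule Ints_diff[OF Ints_minus[OF mult[OF j]]]) (use pow[of n] j in auto)
      then show "l j - of_int k * g j \<in> \<int>" unfolding *[OF j] n by simp
    qed
  qed
qed

end

text \<open>Dimension \<open>d\<close> forces the at most \<open>d + 1\<close> points to be distinct
  and affinely independent. They are then extreme points, hence belong to any finite set of lattice
  points with the same hull.\<close>

lemma coordinate_simplexI:
  assumes M: "is_lattice M" and simplex: "lattice_simplex M d (convex hull (v ` {..d}))"
  shows "coordinate_simplex M v d"
proof -
  let ?V = "v ` {..d}"
  have dim: "aff_dim ?V = int d" using simplex by (simp add: lattice_simplex_def aff_dim_convex_hull)
  then have "int d \<le> int (card ?V) - 1" using aff_dim_le_card[of ?V] by simp
  moreover have "card ?V \<le> d + 1" using card_image_le[of "{..d}" v] by simp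
  ultimately have card: "card ?V = d + 1" by simp
  then have inj: "inj_on v {..d}" by (intro eq_card_imp_inj_on) simp_all
  have indep: "\<not> affine_dependent ?V"
    unfolding affine_independent_iff_card using dim card by simp
  obtain T where T: "finite T" "T \<subseteq> M" "convex hull ?V = convex hull T"
    using simplex unfolding lattice_simplex_def lattice_polytope_def by blast
  have "v j \<in> M" if "j \<le> d" for j
  proof -
    have "v j extreme_point_of convex hull ?V"
      using that by (simp add: extreme_point_of_convex_hull_affine_independent[OF indep])
    then show ?thesis unfolding T(3) using extreme_point_of_convex_hull T(2) by blast
  qed
  then show ?thesis using M inj indep by unfold_locales auto
qed

section \<open>Unimodality from symmetry and monotonicity of the layers\<close>

theorem corollary5p1:
  fixes M \<Delta> :: "'a::euclidean_space set"
    and v :: "nat \<Rightarrow> 'a"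
    and a :: "nat \<Rightarrow> int"
    and d N :: nat
  assumes "is_lattice M"
    and "\<Delta> = convex hull (v ` {..d})"
    and "lattice_simplex M d \<Delta>"
    and "IDP M \<Delta>"
    and "cyclic_group (coord_group M d v)"
    and "Coset.order (coord_group M d v) = N"
    and "N > 1"
    and "\<And>j. j \<le> d \<Longrightarrow> 0 \<le> a j \<and> a j < int N"
    and "(\<lambda>j\<in>{..d}. real_of_int (a j) / real N) \<in> carrier (coord_group M d v)"
    and "subgroup_generated (coord_group M d v) {\<lambda>j\<in>{..d}. real_of_int (a j) / real N}
           = coord_group M d v"
    and "\<And>j. j \<le> d \<Longrightarrow> a j \<noteq> 0 \<Longrightarrow> gcd (a j) (int N) = 1"
  shows "hstar_unimodal M \<Delta>"
proof -
  interpret coordinate_simplex M v d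
    using assms(1-3) by (simp add: coordinate_simplexI)
  have card_G: "card (carrier (coord_group M d v)) = N"
    using assms(6) by (simp add: Coset.order_def)
  then have fin_G: "finite (carrier (coord_group M d v))"
    using assms(7) by (intro card_ge_0_finite) simp
  define S where "S = {j. j \<le> d \<and> a j \<noteq> 0}"
  have S: "finite S" "S \<subseteq> {..d}" by (auto simp: S_def)
  define L where "L = {x \<in> coord_lattice. \<forall>j. j \<notin> S \<longrightarrow> x j = 0}"
  have Ints_unit: "t = 0" if "t \<in> \<int>" "0 \<le> t" "t < 1" for t :: real
    using that by (auto elim!: Ints_cases)
  have multiple: "\<exists>k::int. \<forall>j\<le>d. l j - of_int k * (a j / N) \<in> \<int>" if "l \<in> carrier (coord_group M d v)" for l
    using cyclic_coordinates[OF assms(9,10) that] by auto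
  have carrier_range: "0 \<le> l j" "l j < 1" if "l \<in> carrier (coord_group M d v)" "j \<le> d" for l j
    using that by (auto simp: carrier_coord_group PiE_iff)
  have off_support: "l j = 0" if l: "l \<in> carrier (coord_group M d v)" and j: "j \<le> d" "j \<notin> S" for l j
  proof -
    have "l j \<in> \<int>" using multiple[OF l] j by (auto simp: S_def)
    then show ?thesis using carrier_range[OF l j(1)] by (intro Ints_unit)
  qed
  \<comment> \<open>If \<open>l\<close> is \<open>k\<close> times the generator modulo integers,
    then \<open>l i = 0\<close> gives \<open>N dvd k * a i\<close>, so \<open>N dvd k\<close> by
    coprimality. All coordinates of \<open>l\<close> are then integers in
    \<open>[0, 1)\<close>.\<close>
  have full_support: "l j = 0"
    if l: "l \<in> carrier (coord_group M d v)" and i: "i \<in> S" "l i = 0" and j: "j \<le> d" for l i j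
  proof -
    obtain k :: int where k: "\<And>j. j \<le> d \<Longrightarrow> l j - of_int k * (a j / N) \<in> \<int>"
      using multiple[OF l] by blast
    obtain m :: int where "of_int k * (a i / N) = of_int m"
      using k[of i] i Ints_minus[of "- (of_int k * (a i / N))"] by (auto simp: S_def elim!: Ints_cases)
    then have "real_of_int (k * a i) = real_of_int (int N * m)"
      using assms(7) by (simp add: field_simps)
    then have "k * a i = int N * m" by (simp only: of_int_eq_iff)
    then have "int N dvd k * a i" by simp
    moreover have "coprime (int N) (a i)"
      using assms(11)[of i] i by (simp add: S_def coprime_iff_gcd_eq_1 gcd.commute)
    ultimately have "int N dvd k" by (simp add: coprime_dvd_mult_left_iff)
    then obtain t where "k = int N * t" by blast
    then have "of_int k * (a j / N) = of_int (t * a j)" using assms(7) by simp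
    then have "l j - of_int (t * a j) \<in> \<int>" using k[OF j] by simp
    then have "l j \<in> \<int>" using Ints_add[OF _ Ints_of_int] by (metis diff_add_cancel)
    then show ?thesis using carrier_range[OF l j] by (intro Ints_unit)
  qed
  interpret box_lattice S L
  proof
    show "x j = 0" if "x \<in> L" "\<And>j. j \<in> S \<Longrightarrow> 0 \<le> x j \<and> x j < 1" "i \<in> S" "x i = 0" "j \<in> S" for x i j
    proof -
      have "restrict x {..d} \<in> carrier (coord_group M d v)"
        using that(1,2) by (intro cells_carrier) (fastforce simp: L_def)+
      moreover have "i \<le> d" "j \<le> d" using that(3,5) S(2) by auto
      ultimately show ?thesis using full_support[of "restrict x {..d}" i j] that(3,4) by simp
    qed
  qed (use S in \<open>auto simp: L_def coord_diff coord_unit\<close>)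
  \<comment> \<open>Off \<open>S\<close> the generator is 0, so box points have integer coordinates
    in \<open>[0, 1)\<close> there; restricting to \<open>S\<close> loses none of them.\<close>
  have layer: "layer n = cells {..d} n" for n
  proof (intro equalityI subsetI)
    fix x assume x: "x \<in> layer n"
    have "(\<Sum>j\<le>d. x j) = (\<Sum>j\<in>S. x j)"
      using x S outside[of x] by (intro sum.mono_neutral_right) (auto simp: layer_def)
    moreover have "0 \<le> x j \<and> x j < 1" for j
      using layerD[OF x] outside[of x j] by (cases "j \<in> S") auto
    ultimately show "x \<in> cells {..d} n" using layerD(1,4)[OF x] by (simp add: cells_def L_def)
  next
    fix x assume x: "x \<in> cells {..d} n"
    then have x': "x \<in> coord_lattice" "\<And>j. j \<le> d \<Longrightarrow> 0 \<le> x j \<and> x j < 1" "(\<Sum>j\<le>d. x j) = real n"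
      by (auto simp: cells_def)
    have out: "x j = 0" if "j \<notin> S" for j
      using off_support[OF cells_carrier[OF x'(1,2)], of j] that x'(1)
      by (cases "j \<le> d") (auto simp: coord_lattice_def)
    have "(\<Sum>j\<in>S. x j) = (\<Sum>j\<le>d. x j)"
      using S out by (intro sum.mono_neutral_left) auto
    moreover have "x \<in> L" using x'(1) out by (simp add: L_def)
    ultimately show "x \<in> layer n" using x'(2,3) S(2) by (auto simp: layer_def)
  qed
  interpret idp_box_lattice S L
    by unfold_locales
      (use idp_cells assms(2,4) in \<open>simp_all add: layer finite_box_cells[OF fin_G]\<close>)
  define c where "c n = card (layer n)" for n
  have coeff_c: "coeff (hstar_poly M \<Delta>) n = int (c n)" for n
    using coeff_hstar_poly[OF finite_box_cells[OF fin_G]] by (simp add: assms(2) c_def layer)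
  define s where "s = card S"
  have "s \<le> d + 1" using card_mono[OF _ S(2)] by (simp add: s_def)
  have c_0: "c 0 = 1"
  proof -
    have "layer 0 = {\<lambda>j. 0}"
    proof (intro equalityI subsetI)
      fix x assume x: "x \<in> layer 0"
      then have "x j = 0" for j
        using sum_nonneg_eq_0_iff[OF S(1), of x] layerD[OF x] outside[of x j] by (cases "j \<in> S") auto
      then show "x \<in> {\<lambda>j. 0}" by auto
    next
      fix x :: "nat \<Rightarrow> real" assume "x \<in> {\<lambda>j. 0}"
      moreover have "(\<lambda>j. 0) \<in> L"
        using lattice_arith(1)[OF assms(1)] by (simp add: L_def coord_lattice_def pt_def)
      ultimately show "x \<in> layer 0" by (simp add: layer_def)
    qed
    then show ?thesis by (simp add: c_def)
  qed
  have c_large: "c n = 0" if "s \<le> n" "1 \<le> n" for n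
    using layer_height_less[of _ n] that by (auto simp: c_def s_def card_eq_0_iff)
  have c_sym: "c (s - n) = c n" if "1 \<le> n" "n < s" for n
    using card_layer_reflect that by (simp add: c_def s_def)
  have c_mono: "c n \<le> c (Suc n)" if "1 \<le> n" "2 * n < s" for n
    using card_layer_mono that by (simp add: c_def s_def)
  \<comment> \<open>A nontrivial group element has some height \<open>n\<close> with
    \<open>1 \<le> n < s\<close>, and its decomposition supplies a box point of height 1.\<close>
  have "2 \<le> s" and c_1: "1 \<le> c 1"
  proof -
    have "\<exists>l\<in>carrier (coord_group M d v). l \<noteq> (\<lambda>j\<in>{..d}. 0)"
    proof (rule ccontr)
      assume "\<not> ?thesis"
      then have "carrier (coord_group M d v) \<subseteq> {\<lambda>j\<in>{..d}. 0}" by auto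
      from card_mono[OF _ this] show False using card_G assms(7) by simp
    qed
    then obtain l where l: "l \<in> carrier (coord_group M d v)" "l \<noteq> (\<lambda>j\<in>{..d}. 0)" by blast
    define x where "x j = (if j \<le> d then l j else 0)" for j
    have x: "x \<in> coord_lattice" "\<forall>j\<le>d. 0 \<le> x j \<and> x j < 1"
      using l(1) pt_cong[of x l] by (auto simp: coord_lattice_def carrier_coord_group x_def)
    have nonneg: "0 \<le> (\<Sum>j\<le>d. x j)" using x(2) by (intro sum_nonneg) auto
    moreover have "(\<Sum>j\<le>d. x j) \<in> \<int>" using x(1) by (simp add: coord_lattice_def)
    ultimately obtain n where n: "(\<Sum>j\<le>d. x j) = real n"
      by (metis Ints_cases of_int_0_le_iff of_int_of_nat_eq zero_le_imp_eq_int)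
    have "n \<noteq> 0"
    proof
      assume "n = 0"
      then have "\<forall>j\<le>d. x j = 0"
        using n x(2) sum_nonneg_eq_0_iff[of "{..d}" x] by auto
      then have "l j = (\<lambda>j\<in>{..d}. 0) j" for j
        using l(1) by (auto simp: x_def carrier_coord_group PiE_iff extensional_def)
      then show False using l(2) by blast
    qed
    then have n1: "1 \<le> n" by simp
    have x_layer: "x \<in> layer n" unfolding layer using x n by (simp add: cells_def)
    then show "2 \<le> s" using layer_height_less[OF x_layer n1] n1 by (simp add: s_def)
    have "layer 1 \<noteq> {}" using idp[OF n1 x_layer] n1 by fastforce
    then show "1 \<le> c 1" using finite_layer by (simp add: c_def card_gt_0_iff Suc_leI)
  qed
  have dim: "nat (aff_dim \<Delta>) = d"
    using assms(3) by (simp add: lattice_simplex_def)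
  have "unimodal_seq d (coeff (hstar_poly M \<Delta>))"
    unfolding unimodal_seq_def coeff_c
  \<comment> \<open>The peak is the centre of the symmetry \<open>n \<mapsto> s - n\<close>. The
    descent mirrors \<open>c_mono\<close>, and from \<open>s\<close> on all coefficients
    vanish.\<close>
  proof (intro exI[of _ "s div 2"] conjI allI impI)
    show "s div 2 \<le> d" using \<open>s \<le> d + 1\<close> \<open>2 \<le> s\<close> by linarith
  next
    fix i assume i: "i < s div 2"
    show "int (c i) \<le> int (c (Suc i))"
    proof (cases "i = 0")
      case True
      then show ?thesis using c_0 c_1 by simp
    next
      case False
      then show ?thesis using c_mono[of i] i by simp
    qed
  next
    fix i assume i: "s div 2 \<le> i \<and> i < d"
    show "int (c (Suc i)) \<le> int (c i)"
    proof (cases "Suc i < s")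
      case True
      have "c (Suc i) = c (s - Suc i)" "c (s - i) = c i"
        using c_sym[of "Suc i"] c_sym[of i] True i \<open>2 \<le> s\<close> by auto
      moreover have "c (s - Suc i) \<le> c (Suc (s - Suc i))"
        using True i by (intro c_mono) linarith+
      moreover have "Suc (s - Suc i) = s - i" using True by simp
      ultimately show ?thesis by simp
    next
      case False
      then show ?thesis using c_large[of "Suc i"] by simp
    qed
  qed
  then show ?thesis unfolding hstar_unimodal_def dim .
qed

end
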